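(* Let $\alpha\in(1/2,2)$ and write $\boldsymbol\rho^\sharp=\boldsymbol\rho^\sharp(\alpha)$. We have the following dichotomy. (a) If $\sum_{m=0}^n\alpha^m\rho^\sharp_m\neq0$ for all $n\in\mathbb N_0$, then the function $f_\alpha$ has exactly two maximizers in $[0,1]$. They are given by $\tau^\sharp(\alpha)$ and $1-\tau^\sharp(\alpha)$ and have $\boldsymbol\rho^\sharp$ and $-\boldsymbol\rho^\sharp$ as their Rademacher expansions. (b) Otherwise, let $n_0$ be the smallest $n$ such that $\sum_{m=0}^n\alpha^m\rho^\sharp_m=0$. Then the set of maximizers of $f_\alpha$ consists of all those $t\in[0,1]$ that have a Rademacher expansion consisting of successive blocks of the form $\rho^\sharp_0,\dots,\rho^\sharp_{n_0}$ or $(-\rho^\sharp_0),\dots,(-\rho^\sharp_{n_0})$. This is a perfect set of Hausdorff dimension $1/(n_0+1)$, and its $1/(n_0+1)$-dimensional Hausdorff measure is finite and strictly positive.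
   Context: For $\alpha\in(-2,2)$, $f_\alpha(t)=\sum_{m=0}^\infty\frac{\alpha^m}{2^m}\phi(2^mt)$, $t\in[0,1]$, where $\phi(t)=\min_{z\in\mathbb Z}|t-z|$. Maximizers are points where the global maximum over $[0,1]$ is attained. The sequence $\boldsymbol\rho^\sharp(\alpha)\in\{-1,+1\}^{\mathbb N_0}$ is defined recursively by $\rho_0^\sharp(\alpha)=1$ and, for $n\ge1$, $\rho_n^\sharp(\alpha)=+1$ if $\sum_{m=0}^{n-1}\alpha^m\rho_m^\sharp(\alpha)\le0$ and $\rho_n^\sharp(\alpha)=-1$ otherwise. For a $\{-1,+1\}$-valued sequence $\boldsymbol\rho=(\rho_n)_{n\in\mathbb N_0}$, $T(\boldsymbol\rho):=\sum_{n=0}^\infty2^{-(n+2)}(1-\rho_n)\in[0,1]$, and $\boldsymbol\rho$ is called a Rademacher expansion of $t$ if $T(\boldsymbol\rho)=t$. Finally $\tau^\sharp(\alpha):=T(\boldsymbol\rho^\sharp(\alpha))$. A perfect set is a closed set without isolated points. *)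

theory Defs
  imports "HOL-Analysis.Analysis"
begin

definition dist_to_int :: "real \<Rightarrow> real" where
  "dist_to_int t = (INF z::int. \<bar>t - of_int z\<bar>)"

text \<open>The infimum above is attained, so it is the minimum.\<close>

lemma dist_to_int_attained:
  "\<exists>z::int. dist_to_int t = \<bar>t - of_int z\<bar> \<and> (\<forall>w::int. dist_to_int t \<le> \<bar>t - of_int w\<bar>)"
proof -
  have "dist_to_int t = \<bar>t - of_int (round t)\<bar>"
    unfolding dist_to_int_def
  proof (rule cInf_eq_minimum)
    show "\<bar>t - of_int (round t)\<bar> \<in> range (\<lambda>z::int. \<bar>t - of_int z\<bar>)" by blast
    show "\<bar>t - of_int (round t)\<bar> \<le> x" if "x \<in> range (\<lambda>z::int. \<bar>t - of_int z\<bar>)" for x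
      using that round_diff_minimal[of t] by auto
  qed
  thus ?thesis using round_diff_minimal[of t] by auto
qed

definition takagi_landsberg :: "real \<Rightarrow> real \<Rightarrow> real" where
  "takagi_landsberg \<alpha> t = (\<Sum>m. \<alpha> ^ m / 2 ^ m * dist_to_int (2 ^ m * t))"

lemma summable_takagi_landsberg:
  assumes "\<alpha> \<in> {-2<..<2}"
  shows "summable (\<lambda>m. \<alpha> ^ m / 2 ^ m * dist_to_int (2 ^ m * t))"
proof (rule summable_comparison_test')
  show "summable (\<lambda>m. \<bar>\<alpha> / 2\<bar> ^ m)"
    using assms by (intro summable_geometric) auto
  fix m :: nat
  have "\<bar>dist_to_int s\<bar> \<le> 1" for s
  proof -
    obtain z where z: "dist_to_int s = \<bar>s - of_int z\<bar>"
        "\<forall>w::int. dist_to_int s \<le> \<bar>s - of_int w\<bar>"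
      using dist_to_int_attained[of s] by blast
    have "dist_to_int s \<ge> 0" unfolding z(1) by simp
    moreover have "dist_to_int s \<le> \<bar>s - of_int \<lfloor>s\<rfloor>\<bar>" using z(2) by blast
    moreover have "\<bar>s - of_int \<lfloor>s\<rfloor>\<bar> \<le> 1" by linarith
    ultimately show ?thesis by linarith
  qed
  from mult_left_mono[OF this, of "\<bar>\<alpha> / 2\<bar> ^ m"]
  show "norm (\<alpha> ^ m / 2 ^ m * dist_to_int (2 ^ m * t)) \<le> \<bar>\<alpha> / 2\<bar> ^ m"
    by (simp add: abs_mult power_divide power_abs)
qed

definition maximizers :: "(real \<Rightarrow> real) \<Rightarrow> real set" where
  "maximizers f = {t \<in> {0..1}. \<forall>s\<in>{0..1}. f s \<le> f t}"

function rho_sharp :: "real \<Rightarrow> nat \<Rightarrow> real" where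
  "rho_sharp \<alpha> 0 = 1"
| "rho_sharp \<alpha> (Suc n) = (if (\<Sum>m<Suc n. \<alpha> ^ m * rho_sharp \<alpha> m) \<le> 0 then 1 else -1)"
  by pat_completeness auto
termination by (relation "Wellfounded.measure snd") auto

definition sign_seq :: "(nat \<Rightarrow> real) \<Rightarrow> bool" where
  "sign_seq \<rho> \<longleftrightarrow> (\<forall>n. \<rho> n \<in> {-1, 1})"

definition rademacher_T :: "(nat \<Rightarrow> real) \<Rightarrow> real" where
  "rademacher_T \<rho> = (\<Sum>n. (1 - \<rho> n) / 2 ^ (n + 2))"

definition rademacher_expansion :: "(nat \<Rightarrow> real) \<Rightarrow> real \<Rightarrow> bool" where
  "rademacher_expansion \<rho> t \<longleftrightarrow> sign_seq \<rho> \<and> rademacher_T \<rho> = t"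

definition tau_sharp :: "real \<Rightarrow> real" where
  "tau_sharp \<alpha> = rademacher_T (rho_sharp \<alpha>)"

definition signed_blocks :: "(nat \<Rightarrow> real) \<Rightarrow> nat \<Rightarrow> (nat \<Rightarrow> real) \<Rightarrow> bool" where
  "signed_blocks \<sigma> n \<rho> \<longleftrightarrow>
     (\<forall>k. (\<forall>j\<le>n. \<rho> (k * (n + 1) + j) = \<sigma> j) \<or> (\<forall>j\<le>n. \<rho> (k * (n + 1) + j) = - \<sigma> j))"

definition perfect_set :: "'a::topological_space set \<Rightarrow> bool" where
  "perfect_set S \<longleftrightarrow> closed S \<and> (\<forall>x. \<not> x isolated_in S)"

text \<open>The \<open>s\<close>-th power of the diameter, with the conventions that the empty set contributes
  \<open>0\<close> and that \<open>0\<close> to the power \<open>0\<close> is \<open>1\<close> (whereas \<open>0 powr 0 = 0\<close> in the library).\<close>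

definition diam_power :: "real \<Rightarrow> 'a::metric_space set \<Rightarrow> ennreal" where
  "diam_power s U = (if U = {} then 0 else if s = 0 then 1 else ennreal (diameter U powr s))"

text \<open>Boundedness is required explicitly because \<open>diameter\<close> is unspecified on unbounded sets.
  Finite covers are included, since some \<open>U i\<close> may be empty. The measure is not normalised
  by a volume constant.\<close>

definition hausdorff_premeasure :: "real \<Rightarrow> real \<Rightarrow> 'a::metric_space set \<Rightarrow> ennreal" where
  "hausdorff_premeasure s \<delta> S =
     (INF U \<in> {U :: nat \<Rightarrow> 'a set. S \<subseteq> (\<Union>i. U i) \<and> (\<forall>i. bounded (U i) \<and> diameter (U i) \<le> \<delta>)}.
        (\<Sum>i. diam_power s (U i)))"

definition hausdorff_measure :: "real \<Rightarrow> 'a::metric_space set \<Rightarrow> ennreal" where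
  "hausdorff_measure s S = (SUP \<delta>\<in>{0<..}. hausdorff_premeasure s \<delta> S)"

definition hausdorff_dim :: "'a::metric_space set \<Rightarrow> ereal" where
  "hausdorff_dim S = (INF s\<in>{s. 0 \<le> s \<and> hausdorff_measure s S = 0}. ereal s)"

end

theory Submission
  imports Defs
begin

text \<open>
  Let \<open>S n\<close> be the sum of \<open>\<alpha> ^ m * \<rho> m\<close> over \<open>m < n\<close> and \<open>r n\<close> the sum of \<open>\<rho> (n + k) / 2 ^ k\<close> over
  all \<open>k\<close>. Flipping all signs of \<open>\<rho>\<close> from index \<open>n\<close> on changes the value of the function at
  \<open>rademacher_T \<rho>\<close> by exactly \<open>r n * S n / 2 ^ (n + 1)\<close>. So \<open>r n * S n \<le> 0\<close> at a maximizer, and as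
  \<open>r n\<close> has the sign of \<open>\<rho> n\<close> unless it vanishes (which \<open>\<alpha> > 1/2\<close> excludes), each sign is opposite
  to the preceding partial sum. This determines \<open>\<rho>\<close> up to a free choice of sign at every zero of
  \<open>S\<close>, where a flip does not change the value. If there is such a zero, the choices are made once
  per block of length \<open>n\<^sub>0 + 1\<close>, and the maximizers form a homogeneous Cantor set of ratio
  \<open>2 ^ -(n\<^sub>0 + 1)\<close>, two pieces at each stage.
\<close>

section \<open>Rademacher expansions\<close>

text \<open>Up to an integer, \<open>2 ^ m * rademacher_T \<rho>\<close> equals
  \<open>1/2 - tail_sum \<rho> m / 4\<close>. The values lie in [-2, 2].\<close>

definition tail_sum :: "(nat \<Rightarrow> real) \<Rightarrow> nat \<Rightarrow> real" where
  "tail_sum \<rho> m = (\<Sum>k. \<rho> (m + k) / 2 ^ k)"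

definition partial_sum :: "real \<Rightarrow> (nat \<Rightarrow> real) \<Rightarrow> nat \<Rightarrow> real" where
  "partial_sum \<alpha> \<rho> n = (\<Sum>m<n. \<alpha> ^ m * \<rho> m)"

text \<open>Flipping a whole tail reflects the point in the midpoint of the dyadic interval given by
  its first \<open>n\<close> digits, so the summands of the function with index at least
  \<open>n\<close> keep their values.\<close>

definition flip_from :: "nat \<Rightarrow> (nat \<Rightarrow> real) \<Rightarrow> nat \<Rightarrow> real" where
  "flip_from n \<rho> m = (if m < n then \<rho> m else - \<rho> m)"

lemma sign_seqD: "sign_seq \<rho> \<Longrightarrow> \<rho> n = 1 \<or> \<rho> n = -1"
  unfolding sign_seq_def by auto

lemma sign_seq_abs: "sign_seq \<rho> \<Longrightarrow> \<bar>\<rho> n\<bar> = 1"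
  using sign_seqD[of \<rho> n] by auto

lemma sign_seq_square: "sign_seq \<rho> \<Longrightarrow> \<rho> n * \<rho> n = 1"
  using sign_seqD[of \<rho> n] by auto

lemma sign_seq_flip_from: "sign_seq \<rho> \<Longrightarrow> sign_seq (flip_from n \<rho>)"
  unfolding sign_seq_def flip_from_def by force

lemma sign_seq_shift: "sign_seq \<rho> \<Longrightarrow> sign_seq (\<lambda>k. \<rho> (m + k))"
  unfolding sign_seq_def by auto

lemma sign_seq_uminus: "sign_seq \<rho> \<Longrightarrow> sign_seq (\<lambda>n. - \<rho> n)"
  unfolding sign_seq_def by force

lemma summable_bounded_power:
  fixes a :: "nat \<Rightarrow> real"
  assumes "\<And>k. \<bar>a k\<bar> \<le> B" "\<bar>q\<bar> < 1"
  shows "summable (\<lambda>k. a k * q ^ k)"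
proof (rule summable_comparison_test')
  show "summable (\<lambda>k. B * \<bar>q\<bar> ^ k)"
    using assms by (intro summable_mult summable_geometric) auto
  show "norm (a k * q ^ k) \<le> B * \<bar>q\<bar> ^ k" for k
    using assms(1)[of k] by (simp add: abs_mult power_abs mult_right_mono)
qed

lemma sign_seq_summable_power:
  assumes "sign_seq \<rho>" "\<bar>q\<bar> < 1"
  shows "summable (\<lambda>k. \<rho> k * q ^ k)"
  using summable_bounded_power[of \<rho> 1 q] sign_seq_abs[OF assms(1)] assms(2) by simp

lemma summable_tail_sum:
  assumes "sign_seq \<rho>"
  shows "summable (\<lambda>k. \<rho> (m + k) / 2 ^ k)"
  using sign_seq_summable_power[OF sign_seq_shift[OF assms], of "1/2"]
  by (simp add: power_divide)

lemma tail_sum_Suc: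
  assumes "sign_seq \<rho>"
  shows "tail_sum \<rho> m = \<rho> m + tail_sum \<rho> (Suc m) / 2"
proof -
  have "tail_sum \<rho> m = \<rho> m + (\<Sum>k. \<rho> (Suc m + k) / 2 ^ k / 2)"
    unfolding tail_sum_def
    using suminf_split_head[OF summable_tail_sum[OF assms], of m] by (simp add: algebra_simps)
  also have "(\<Sum>k. \<rho> (Suc m + k) / 2 ^ k / 2) = tail_sum \<rho> (Suc m) / 2"
    unfolding tail_sum_def by (rule suminf_divide[OF summable_tail_sum[OF assms]])
  finally show ?thesis .
qed

lemma abs_tail_sum_le:
  assumes "sign_seq \<rho>"
  shows "\<bar>tail_sum \<rho> m\<bar> \<le> 2"
proof -
  have s: "summable (\<lambda>k. \<bar>\<rho> (m + k) / 2 ^ k\<bar>)"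
    using sign_seq_abs[OF assms] summable_geometric[of "1/2::real"]
    by (simp add: power_divide)
  have "\<bar>tail_sum \<rho> m\<bar> \<le> (\<Sum>k. \<bar>\<rho> (m + k) / 2 ^ k\<bar>)"
    unfolding tail_sum_def by (rule summable_rabs[OF s])
  also have "\<dots> = (\<Sum>k. (1/2) ^ k)"
    using sign_seq_abs[OF assms] by (simp add: power_divide)
  also have "\<dots> = 2" by (subst suminf_geometric) auto
  finally show ?thesis .
qed

lemma rademacher_T_eq:
  assumes "sign_seq \<rho>"
  shows "rademacher_T \<rho> = 1/2 - tail_sum \<rho> 0 / 4"
proof -
  have "(\<lambda>n. (1/2) ^ n / 4 - \<rho> n / 2 ^ n / 4) sums (2 / 4 - tail_sum \<rho> 0 / 4)"
  proof (intro sums_diff sums_divide)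
    show "(\<lambda>n. (1/2::real) ^ n) sums 2" using geometric_sums[of "1/2::real"] by simp
    show "(\<lambda>n. \<rho> n / 2 ^ n) sums tail_sum \<rho> 0"
      using summable_sums[OF summable_tail_sum[OF assms, of 0]] by (simp add: tail_sum_def)
  qed
  moreover have "(\<lambda>n. (1/2) ^ n / 4 - \<rho> n / 2 ^ n / 4) = (\<lambda>n. (1 - \<rho> n) / 2 ^ (n + 2))"
    by (simp add: fun_eq_iff power_add power_divide field_simps)
  ultimately show ?thesis unfolding rademacher_T_def by (simp add: sums_iff)
qed

lemma rademacher_T_in_unit: "sign_seq \<rho> \<Longrightarrow> rademacher_T \<rho> \<in> {0..1}"
  using abs_tail_sum_le[of \<rho> 0] by (simp add: rademacher_T_eq abs_le_iff)

lemma tail_sum_uminus: "sign_seq \<rho> \<Longrightarrow> tail_sum (\<lambda>n. - \<rho> n) m = - tail_sum \<rho> m"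
  unfolding tail_sum_def using suminf_minus[OF summable_tail_sum[of \<rho> m]] by simp

lemma rademacher_T_uminus: "sign_seq \<rho> \<Longrightarrow> rademacher_T (\<lambda>n. - \<rho> n) = 1 - rademacher_T \<rho>"
  by (simp add: rademacher_T_eq sign_seq_uminus tail_sum_uminus)

lemma rademacher_expansion_exists:
  assumes "t \<in> {0..1}"
  shows "\<exists>\<rho>. rademacher_expansion \<rho> t"
proof -
  \<comment> \<open>The orbit of \<open>t\<close> under doubling modulo 1, with digit -1 in the
    upper half. The point 1 is mapped to itself, so \<open>t = 1\<close> gets only digits
    -1.\<close>
  define x where "x = rec_nat t (\<lambda>_ y. if y \<ge> 1/2 then 2 * y - 1 else 2 * y)"
  have x0: "x 0 = t" and xS: "x (Suc n) = (if x n \<ge> 1/2 then 2 * x n - 1 else 2 * x n)" for n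
    by (simp_all add: x_def)
  have xb: "0 \<le> x n \<and> x n \<le> 1" for n
    by (induction n) (use assms in \<open>auto simp: x0 xS\<close>)
  define \<rho> where "\<rho> n = (if x n \<ge> 1/2 then -1 else 1::real)" for n
  have sg: "sign_seq \<rho>" by (auto simp: sign_seq_def \<rho>_def)
  have part: "(\<Sum>n<N. (1 - \<rho> n) / 2 ^ (n + 2)) = t - x N / 2 ^ N" for N
  proof (induction N)
    case (Suc N)
    have "(1 - \<rho> N) / 2 ^ (N + 2) = x N / 2 ^ N - x (Suc N) / 2 ^ Suc N"
      by (simp add: xS \<rho>_def field_simps)
    then show ?case using Suc by simp
  qed (simp add: x0)
  have "(\<lambda>N. x N / 2 ^ N) \<longlonglongrightarrow> 0"
  proof (rule Lim_null_comparison)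
    show "\<forall>\<^sub>F N in sequentially. norm (x N / 2 ^ N) \<le> (1/2) ^ N"
      using xb by (intro always_eventually) (auto simp: power_divide divide_right_mono)
    show "(\<lambda>N. (1/2::real) ^ N) \<longlonglongrightarrow> 0" by (rule LIMSEQ_realpow_zero) auto
  qed
  then have "(\<lambda>N. t - x N / 2 ^ N) \<longlonglongrightarrow> t - 0" by (intro tendsto_intros)
  then have "(\<lambda>n. (1 - \<rho> n) / 2 ^ (n + 2)) sums t"
    unfolding sums_def part by simp
  then show ?thesis
    using sg unfolding rademacher_expansion_def rademacher_T_def by (auto simp: sums_iff)
qed

lemma tail_sum_split:
  assumes "sign_seq \<rho>"
  shows "tail_sum \<rho> m = (\<Sum>k<n. \<rho> (m + k) / 2 ^ k) + tail_sum \<rho> (m + n) / 2 ^ n"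
proof (induction n)
  case (Suc n)
  then show ?case
    using tail_sum_Suc[OF assms, of "m + n"] by (simp add: field_simps)
qed simp

text \<open>The first \<open>n\<close> digits fix a closed dyadic interval of length
  \<open>1 / 2 ^ n\<close>, which contains both points.\<close>

lemma rademacher_T_close:
  assumes "sign_seq \<rho>" "sign_seq \<rho>'" "\<And>k. k < n \<Longrightarrow> \<rho> k = \<rho>' k"
  shows "\<bar>rademacher_T \<rho> - rademacher_T \<rho>'\<bar> \<le> 1 / 2 ^ n"
proof -
  have "rademacher_T \<rho> - rademacher_T \<rho>' = (tail_sum \<rho>' n - tail_sum \<rho> n) / 4 / 2 ^ n"
    using tail_sum_split[OF assms(1), of 0 n] tail_sum_split[OF assms(2), of 0 n] assms(3)
    by (simp add: rademacher_T_eq assms(1,2) field_simps)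
  moreover have "\<bar>(tail_sum \<rho>' n - tail_sum \<rho> n) / 4\<bar> \<le> 1"
    using abs_tail_sum_le[OF assms(1), of n] abs_tail_sum_le[OF assms(2), of n]
    unfolding abs_le_iff by (auto simp: field_simps)
  ultimately show ?thesis
    by (simp only: abs_divide[of _ "2 ^ n"] power_abs abs_numeral) (rule divide_right_mono, simp_all)
qed

text \<open>In \<open>tail_sum_Suc\<close> the later digits contribute at most 1 in absolute value,
  so they cannot outweigh the leading digit.\<close>

lemma sign_times_tail_sum_nonneg:
  assumes "sign_seq \<rho>"
  shows "\<rho> n * tail_sum \<rho> n \<ge> 0"
  using sign_seqD[OF assms, of n] abs_tail_sum_le[OF assms, of "Suc n"] tail_sum_Suc[OF assms, of n]
  by auto

lemma abs_tail_sum: "sign_seq \<rho> \<Longrightarrow> \<bar>tail_sum \<rho> n\<bar> = \<rho> n * tail_sum \<rho> n"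
  using sign_times_tail_sum_nonneg[of \<rho> n] sign_seqD[of \<rho> n] by auto

text \<open>The bound 2 is attained only if the leading digit has the right sign and the next tail
  sum is extreme again.\<close>

lemma tail_sum_extreme:
  assumes "sign_seq \<rho>" "tail_sum \<rho> m = 2 * c" "\<bar>c\<bar> = 1"
  shows "\<rho> (m + k) = c \<and> tail_sum \<rho> (m + k) = 2 * c"
proof -
  have step: "\<rho> n = c \<and> tail_sum \<rho> (Suc n) = 2 * c" if "tail_sum \<rho> n = 2 * c" for n
    using that sign_seqD[OF assms(1), of n] abs_tail_sum_le[OF assms(1), of "Suc n"]
      tail_sum_Suc[OF assms(1), of n] assms(3) by auto
  have "tail_sum \<rho> (m + k) = 2 * c" for k
    by (induction k) (use step assms(2) in auto)
  then show ?thesis using step by blast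
qed

text \<open>Only an extreme tail of the opposite sign can cancel the leading digit. This is the
  expansion of a dyadic point.\<close>

lemma tail_sum_eq_zero:
  assumes "sign_seq \<rho>" "tail_sum \<rho> n = 0"
  shows "\<rho> (Suc n + k) = - \<rho> n \<and> tail_sum \<rho> (Suc n + k) = 2 * - \<rho> n"
  by (rule tail_sum_extreme) (use assms tail_sum_Suc[OF assms(1), of n] sign_seq_abs in auto)

section \<open>The Takagi-Landsberg function along Rademacher expansions\<close>

lemma dist_to_int_le: "dist_to_int t \<le> \<bar>t - of_int z\<bar>"
  using dist_to_int_attained[of t] by blast

lemma dist_to_int_ge:
  assumes "\<And>z::int. c \<le> \<bar>t - of_int z\<bar>"
  shows "c \<le> dist_to_int t"
  using dist_to_int_attained[of t] assms by metis

lemma dist_to_int_add_int: "dist_to_int (t + of_int k) = dist_to_int t"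
proof (rule antisym)
  show "dist_to_int t \<le> dist_to_int (t + of_int k)"
    by (rule dist_to_int_ge) (use dist_to_int_le[of t "_ - k"] in \<open>simp add: algebra_simps\<close>)
  show "dist_to_int (t + of_int k) \<le> dist_to_int t"
    by (rule dist_to_int_ge) (use dist_to_int_le[of "t + of_int k" "_ + k"] in \<open>simp add: algebra_simps\<close>)
qed

lemma dist_to_int_unit:
  assumes "t \<in> {0..1}"
  shows "dist_to_int t = 1/2 - \<bar>t - 1/2\<bar>"
proof (rule antisym)
  show "dist_to_int t \<le> 1/2 - \<bar>t - 1/2\<bar>"
    using dist_to_int_le[of t 0] dist_to_int_le[of t 1] assms by (auto simp: abs_if split: if_splits)
  show "1/2 - \<bar>t - 1/2\<bar> \<le> dist_to_int t"
  proof (rule dist_to_int_ge)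
    fix z :: int
    consider "z \<le> 0" | "z \<ge> 1" by linarith
    then show "1/2 - \<bar>t - 1/2\<bar> \<le> \<bar>t - of_int z\<bar>"
    proof cases
      case 1
      then have "real_of_int z \<le> 0" by simp
      then show ?thesis using assms by auto
    next
      case 2
      then have "real_of_int z \<ge> 1" by simp
      then show ?thesis using assms by auto
    qed
  qed
qed

lemma dist_to_int_lipschitz: "dist_to_int s \<le> dist_to_int t + \<bar>s - t\<bar>"
proof -
  have "dist_to_int s - \<bar>s - t\<bar> \<le> dist_to_int t"
  proof (rule dist_to_int_ge)
    show "dist_to_int s - \<bar>s - t\<bar> \<le> \<bar>t - of_int z\<bar>" for z
      using dist_to_int_le[of s z] by linarith
  qed
  then show ?thesis by simp
qed

lemma continuous_on_dist_to_int: "continuous_on A dist_to_int"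
proof (rule continuous_on_subset)
  have "1-lipschitz_on UNIV dist_to_int"
  proof (rule lipschitz_onI)
    show "dist (dist_to_int x) (dist_to_int y) \<le> 1 * dist x y" for x y
      using dist_to_int_lipschitz[of x y] dist_to_int_lipschitz[of y x]
      by (simp add: dist_real_def abs_le_iff abs_minus_commute)
  qed simp
  then show "continuous_on UNIV dist_to_int" by (rule lipschitz_on_continuous_on)
qed auto

lemma dist_to_int_nonneg: "0 \<le> dist_to_int t"
  by (rule dist_to_int_ge) auto

lemma dist_to_int_le_1: "dist_to_int t \<le> 1"
  using dist_to_int_le[of t "\<lfloor>t\<rfloor>"] by linarith

section \<open>Continuity and existence of maximizers\<close>

lemma continuous_on_takagi_landsberg:
  assumes "\<bar>\<alpha>\<bar> < 2"
  shows "continuous_on A (takagi_landsberg \<alpha>)"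
proof -
  have "uniform_limit A (\<lambda>n t. \<Sum>m<n. \<alpha> ^ m / 2 ^ m * dist_to_int (2 ^ m * t))
      (\<lambda>t. \<Sum>m. \<alpha> ^ m / 2 ^ m * dist_to_int (2 ^ m * t)) sequentially"
  proof (rule Weierstrass_m_test)
    show "norm (\<alpha> ^ m / 2 ^ m * dist_to_int (2 ^ m * t)) \<le> \<bar>\<alpha> / 2\<bar> ^ m" for m t
      using dist_to_int_nonneg[of "2 ^ m * t"] dist_to_int_le_1[of "2 ^ m * t"]
        mult_left_mono[of "dist_to_int (2 ^ m * t)" 1 "\<bar>\<alpha> / 2\<bar> ^ m"]
      by (simp add: abs_mult power_divide power_abs)
    show "summable (\<lambda>m. \<bar>\<alpha> / 2\<bar> ^ m)" using assms by (intro summable_geometric) auto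
  qed
  then have "continuous_on A (\<lambda>t. \<Sum>m. \<alpha> ^ m / 2 ^ m * dist_to_int (2 ^ m * t))"
    by (rule uniform_limit_theorem[rotated])
      (auto intro!: always_eventually continuous_intros
        continuous_on_compose2[OF continuous_on_dist_to_int[of UNIV]])
  then show ?thesis unfolding takagi_landsberg_def[abs_def] .
qed

lemma closed_maximizers:
  assumes "continuous_on {0..1} f"
  shows "closed (maximizers f)"
proof (cases "maximizers f = {}")
  case False
  then obtain t where t: "t \<in> maximizers f" by auto
  \<comment> \<open>The maximizers form the superlevel set at the maximal value, so continuity makes
    them closed.\<close>
  then have "maximizers f = {s \<in> {0..1}. f t \<le> f s}"
    unfolding maximizers_def by (force intro: order_trans)
  moreover have "closed {s \<in> {0..1}. f t \<le> f s}"
    using continuous_closed_preimage[OF assms, of "{f t..}"]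
    by (simp add: vimage_def Int_def)
  ultimately show ?thesis by simp
qed auto

lemma maximizers_nonempty:
  assumes "continuous_on {0..1} f"
  shows "maximizers f \<noteq> {}"
proof -
  have "\<exists>t\<in>{0..1::real}. \<forall>s\<in>{0..1}. f s \<le> f t"
    by (rule continuous_attains_sup) (use assms in auto)
  then show ?thesis by (auto simp: maximizers_def)
qed

section \<open>Values along digit sequences and the effect of a tail flip\<close>

text \<open>Modulo 1, multiplication by \<open>2 ^ m\<close> deletes the first \<open>m\<close>
  digits. The remaining point has distance \<open>\<bar>tail_sum \<rho> m\<bar> / 4\<close> from
  1/2, and the leading digit removes the absolute value.\<close>

lemma dist_to_int_rademacher_T:
  assumes "sign_seq \<rho>"
  shows "dist_to_int (2 ^ m * rademacher_T \<rho>) = 1/2 - \<rho> m * tail_sum \<rho> m / 4"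
proof -
  have "\<exists>k::int. 2 ^ m * rademacher_T \<rho> = 1/2 - tail_sum \<rho> m / 4 + of_int k"
  proof (induction m)
    case 0
    show ?case by (rule exI[of _ 0]) (simp add: rademacher_T_eq assms)
  next
    case (Suc m)
    then obtain k :: int where k: "2 ^ m * rademacher_T \<rho> = 1/2 - tail_sum \<rho> m / 4 + of_int k" ..
    have "2 ^ Suc m * rademacher_T \<rho> = 2 * (1/2 - tail_sum \<rho> m / 4 + of_int k)"
      using k by simp
    \<comment> \<open>Doubling pushes digit \<open>m\<close> across the binary point: a digit -1
      adds the integer 1, a digit 1 adds nothing.\<close>
    also have "\<dots> = 1/2 - tail_sum \<rho> (Suc m) / 4 + of_int (2 * k + (if \<rho> m = 1 then 0 else 1))"
      using sign_seqD[OF assms, of m] tail_sum_Suc[OF assms, of m]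
      by (auto simp: field_simps)
    finally show ?case by blast
  qed
  then obtain k :: int where "2 ^ m * rademacher_T \<rho> = 1/2 - tail_sum \<rho> m / 4 + of_int k" ..
  then have "dist_to_int (2 ^ m * rademacher_T \<rho>) = dist_to_int (1/2 - tail_sum \<rho> m / 4)"
    by (simp only: dist_to_int_add_int)
  also have "\<dots> = 1/2 - \<bar>tail_sum \<rho> m\<bar> / 4"
    using abs_tail_sum_le[OF assms, of m] by (subst dist_to_int_unit) auto
  finally show ?thesis by (simp add: abs_tail_sum assms)
qed

lemma takagi_landsberg_rademacher_T:
  assumes "sign_seq \<rho>"
  shows "takagi_landsberg \<alpha> (rademacher_T \<rho>) = (\<Sum>m. \<alpha> ^ m / 2 ^ m * (1/2 - \<rho> m * tail_sum \<rho> m / 4))"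
  unfolding takagi_landsberg_def dist_to_int_rademacher_T[OF assms] ..

lemma tail_sum_flip_from_ge:
  assumes "sign_seq \<rho>" "n \<le> m"
  shows "tail_sum (flip_from n \<rho>) m = - tail_sum \<rho> m"
  using suminf_minus[OF summable_tail_sum[OF assms(1), of m]] assms(2)
  by (simp add: tail_sum_def flip_from_def)

lemma tail_sum_flip_from_le:
  assumes "sign_seq \<rho>" "m \<le> n"
  shows "tail_sum (flip_from n \<rho>) m = tail_sum \<rho> m - 2 * tail_sum \<rho> n / 2 ^ (n - m)"
proof -
  have "(\<Sum>k<n - m. flip_from n \<rho> (m + k) / 2 ^ k) = (\<Sum>k<n - m. \<rho> (m + k) / 2 ^ k)"
    by (intro sum.cong) (auto simp: flip_from_def)
  then show ?thesis
    using tail_sum_split[OF assms(1), of m "n - m"] assms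
      tail_sum_split[OF sign_seq_flip_from[OF assms(1)], of n m "n - m"]
    by (simp add: tail_sum_flip_from_ge)
qed

lemma partial_sum_flip_from:
  "m \<le> n \<Longrightarrow> partial_sum \<alpha> (flip_from n \<rho>) m = partial_sum \<alpha> \<rho> m"
  unfolding partial_sum_def flip_from_def by (intro sum.cong) auto

text \<open>For \<open>m \<ge> n\<close> both \<open>\<rho> m\<close> and
  \<open>tail_sum \<rho> m\<close> change sign, so the product stays. For \<open>m < n\<close> only
  the tail sum changes, by \<open>- 2 * tail_sum \<rho> n / 2 ^ (n - m)\<close>. The powers of 2
  then combine to a factor independent of \<open>m\<close>.\<close>

lemma takagi_landsberg_flip_from:
  assumes "\<bar>\<alpha>\<bar> < 2" "sign_seq \<rho>"
  shows "takagi_landsberg \<alpha> (rademacher_T (flip_from n \<rho>)) =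
    takagi_landsberg \<alpha> (rademacher_T \<rho>) + tail_sum \<rho> n * partial_sum \<alpha> \<rho> n / 2 ^ (n + 1)"
proof -
  let ?g = "\<lambda>\<rho> m. \<alpha> ^ m / 2 ^ m * (1/2 - \<rho> m * tail_sum \<rho> m / 4)"
  let ?fl = "flip_from n \<rho>"
  have fl: "sign_seq ?fl" using assms(2) by (rule sign_seq_flip_from)
  have smm: "summable (?g \<rho>)" if "sign_seq \<rho>" for \<rho>
    using summable_takagi_landsberg[of \<alpha> "rademacher_T \<rho>"] assms(1)
    by (simp add: dist_to_int_rademacher_T that abs_less_iff)
  have eq: "?g ?fl m - ?g \<rho> m =
      (if m < n then \<alpha> ^ m * \<rho> m * (tail_sum \<rho> n / 2 ^ (n + 1)) else 0)" for m
  proof (cases "m < n")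
    case True
    have p: "(2::real) ^ n = 2 ^ m * 2 ^ (n - m)" using True by (simp flip: power_add)
    show ?thesis
      using True by (simp add: tail_sum_flip_from_le assms(2) p flip_from_def field_simps)
  next
    case False
    then show ?thesis by (simp add: tail_sum_flip_from_ge assms(2)) (simp add: flip_from_def)
  qed
  have "takagi_landsberg \<alpha> (rademacher_T ?fl) - takagi_landsberg \<alpha> (rademacher_T \<rho>)
      = (\<Sum>m. ?g ?fl m - ?g \<rho> m)"
    unfolding takagi_landsberg_rademacher_T[OF fl] takagi_landsberg_rademacher_T[OF assms(2)]
    by (rule suminf_diff[OF smm[OF fl] smm[OF assms(2)]])
  also have "\<dots> = (\<Sum>m<n. \<alpha> ^ m * \<rho> m * (tail_sum \<rho> n / 2 ^ (n + 1)))"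
    unfolding eq by (subst suminf_finite[of "{..<n}"]) auto
  also have "\<dots> = tail_sum \<rho> n * partial_sum \<alpha> \<rho> n / 2 ^ (n + 1)"
    unfolding sum_distrib_right[symmetric] by (simp add: partial_sum_def)
  finally show ?thesis by simp
qed

section \<open>The step condition\<close>

text \<open>A property of digit sequences rather than points, so that the two expansions of a dyadic
  point can be told apart.\<close>

definition optimal :: "real \<Rightarrow> (nat \<Rightarrow> real) \<Rightarrow> bool" where
  "optimal \<alpha> \<rho> \<longleftrightarrow> sign_seq \<rho> \<and> rademacher_T \<rho> \<in> maximizers (takagi_landsberg \<alpha>)"

definition step_condition :: "real \<Rightarrow> (nat \<Rightarrow> real) \<Rightarrow> bool" where
  "step_condition \<alpha> \<rho> \<longleftrightarrow> (\<forall>n. \<rho> n * partial_sum \<alpha> \<rho> n \<le> 0)"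

lemma optimal_sign_seq: "optimal \<alpha> \<rho> \<Longrightarrow> sign_seq \<rho>"
  by (simp add: optimal_def)

text \<open>Used in two ways: a zero partial sum gives another maximizer of equal value, a zero tail
  sum gives the other expansion of the same point.\<close>

lemma optimal_flip_from:
  assumes "\<bar>\<alpha>\<bar> < 2" "optimal \<alpha> \<rho>" "tail_sum \<rho> n * partial_sum \<alpha> \<rho> n = 0"
  shows "optimal \<alpha> (flip_from n \<rho>)"
  using assms takagi_landsberg_flip_from[OF assms(1), of \<rho> n]
  by (auto simp: optimal_def maximizers_def sign_seq_flip_from
      rademacher_T_in_unit[unfolded atLeastAtMost_iff])

lemma optimal_tail_sum:
  assumes "\<bar>\<alpha>\<bar> < 2" "optimal \<alpha> \<rho>"
  shows "tail_sum \<rho> n * partial_sum \<alpha> \<rho> n \<le> 0"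
proof -
  have sg: "sign_seq \<rho>" using assms(2) by (simp add: optimal_def)
  have "takagi_landsberg \<alpha> (rademacher_T (flip_from n \<rho>)) \<le> takagi_landsberg \<alpha> (rademacher_T \<rho>)"
    using assms(2) rademacher_T_in_unit[OF sign_seq_flip_from[OF sg, of n]]
    unfolding optimal_def maximizers_def by blast
  then show ?thesis
    using takagi_landsberg_flip_from[OF assms(1) sg, of n]
    by (simp add: divide_le_0_iff not_le[of "2 ^ n :: real" 0, THEN iffD2])
qed

text \<open>For \<open>\<alpha> < 1\<close> the series has the sum
  \<open>\<alpha> / (1 - \<alpha>)\<close>, which exceeds 1 exactly when
  \<open>\<alpha> > 1/2\<close>; otherwise two terms suffice.\<close>

lemma geometric_partial_sum_gt_1:
  fixes \<alpha> :: real
  assumes "1 / 2 < \<alpha>"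
  shows "\<exists>J. (\<Sum>j<J. \<alpha> ^ Suc j) > 1"
proof (cases "\<alpha> < 1")
  case True
  have "(\<lambda>j. \<alpha> * \<alpha> ^ j) sums (\<alpha> * (1 / (1 - \<alpha>)))"
    by (intro sums_mult geometric_sums) (use True assms in auto)
  then have "(\<lambda>J. \<Sum>j<J. \<alpha> ^ Suc j) \<longlonglongrightarrow> \<alpha> * (1 / (1 - \<alpha>))"
    by (simp add: sums_def)
  moreover have "1 < \<alpha> * (1 / (1 - \<alpha>))" using True assms by (simp add: field_simps)
  ultimately have "\<forall>\<^sub>F J in sequentially. 1 < (\<Sum>j<J. \<alpha> ^ Suc j)"
    by (rule order_tendstoD)
  then show ?thesis by (auto simp: eventually_sequentially)
next
  case False
  then have "\<alpha> \<ge> 1" "\<alpha> ^ 2 \<ge> 1" by (simp_all add: one_le_power)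
  then have "\<alpha> ^ 1 + \<alpha> ^ 2 > 1" unfolding power_one_right by linarith
  then show ?thesis
    by (intro exI[of _ 2]) (simp add: numeral_2_eq_2)
qed

text \<open>A zero tail sum means that the maximizer is dyadic. Flipping the tail then gives a second
  expansion of the same point; for one of the two the partial sums eventually have the same sign
  as all later digits, because \<open>\<alpha> + \<alpha>\<^sup>2 + \<dots> > 1\<close>.\<close>

lemma optimal_tail_sum_nonzero:
  assumes "1 / 2 < \<alpha>" "\<alpha> < 2" "optimal \<alpha> \<rho>"
  shows "tail_sum \<rho> n \<noteq> 0"
proof
  assume z: "tail_sum \<rho> n = 0"
  have abs2: "\<bar>\<alpha>\<bar> < 2" using assms by simp
  have contra: False
    if o: "optimal \<alpha> \<rho>" and z: "tail_sum \<rho> n = 0" and s: "\<rho> n * partial_sum \<alpha> \<rho> n \<le> 0" for \<rho>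
  proof -
    have sg: "sign_seq \<rho>" using o by (simp add: optimal_def)
    have tl: "\<rho> (Suc n + k) = - \<rho> n" "tail_sum \<rho> (Suc n + k) = 2 * - \<rho> n" for k
      using tail_sum_eq_zero[OF sg z, of k] by auto
    obtain J where J: "(\<Sum>j<J. \<alpha> ^ Suc j) > 1"
      using geometric_partial_sum_gt_1[OF assms(1)] by blast
    have ps: "partial_sum \<alpha> \<rho> (Suc n + k)
        = partial_sum \<alpha> \<rho> n + \<alpha> ^ n * \<rho> n * (1 - (\<Sum>j<k. \<alpha> ^ Suc j))" for k
    proof (induction k)
      case (Suc k)
      have "partial_sum \<alpha> \<rho> (Suc n + Suc k)
          = partial_sum \<alpha> \<rho> (Suc n + k) + \<alpha> ^ (Suc n + k) * \<rho> (Suc n + k)"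
        by (simp add: partial_sum_def)
      then show ?case unfolding Suc tl by (simp add: algebra_simps power_add)
    qed (simp add: partial_sum_def)
    \<comment> \<open>At index \<open>Suc n + J\<close> the tail sum is extreme with the sign of
      \<open>- \<rho> n\<close>, while the choice of \<open>J\<close> has given the partial sum that
      same sign. This contradicts optimality.\<close>
    have "- \<rho> n * partial_sum \<alpha> \<rho> (Suc n + J) \<le> 0"
      using optimal_tail_sum[OF abs2 o, of "Suc n + J"] unfolding tl by simp
    moreover have "- \<rho> n * partial_sum \<alpha> \<rho> (Suc n + J)
        = - (\<rho> n * partial_sum \<alpha> \<rho> n) + \<alpha> ^ n * (\<rho> n * \<rho> n) * ((\<Sum>j<J. \<alpha> ^ Suc j) - 1)"
      unfolding ps by (simp only: algebra_simps)
    moreover have "\<alpha> ^ n * (\<rho> n * \<rho> n) * ((\<Sum>j<J. \<alpha> ^ Suc j) - 1) > 0"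
      using J assms(1) by (simp add: sign_seq_square[OF sg])
    ultimately show False using s by linarith
  qed
  show False
  proof (cases "\<rho> n * partial_sum \<alpha> \<rho> n \<le> 0")
    case True
    then show False using contra z assms(3) by blast
  next
    case False
    \<comment> \<open>The flip reverses digit \<open>n\<close> but leaves the partial sum before it
      untouched, so the other expansion satisfies the sign hypothesis of
      \<open>contra\<close>.\<close>
    have "optimal \<alpha> (flip_from n \<rho>)"
      using optimal_flip_from[OF abs2 assms(3)] z by simp
    moreover have "tail_sum (flip_from n \<rho>) n = 0"
      using z by (simp add: tail_sum_flip_from_ge optimal_sign_seq[OF assms(3)])
    moreover have "flip_from n \<rho> n * partial_sum \<alpha> (flip_from n \<rho>) n \<le> 0"
      using False by (simp add: partial_sum_flip_from) (simp add: flip_from_def)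
    ultimately show False by (rule contra)
  qed
qed

lemma optimal_step_condition:
  assumes "1 / 2 < \<alpha>" "\<alpha> < 2" "optimal \<alpha> \<rho>"
  shows "step_condition \<alpha> \<rho>"
  unfolding step_condition_def
proof
  fix n
  have sg: "sign_seq \<rho>" using assms(3) by (rule optimal_sign_seq)
  have t: "tail_sum \<rho> n * partial_sum \<alpha> \<rho> n \<le> 0"
    using optimal_tail_sum[OF _ assms(3)] assms by simp
  have pos: "\<rho> n * tail_sum \<rho> n > 0"
    using sign_times_tail_sum_nonneg[OF sg, of n] optimal_tail_sum_nonzero[OF assms, of n]
      sign_seqD[OF sg, of n] by auto
  show "\<rho> n * partial_sum \<alpha> \<rho> n \<le> 0"
    using sign_seqD[OF sg, of n] t pos by (auto simp: mult_le_0_iff)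
qed

section \<open>Comparison with \<open>rho_sharp\<close>\<close>

lemma sign_seq_rho_sharp: "sign_seq (rho_sharp \<alpha>)"
  unfolding sign_seq_def
proof
  show "rho_sharp \<alpha> n \<in> {-1, 1}" for n by (cases n) auto
qed

lemma rho_sharp_Suc: "rho_sharp \<alpha> (Suc n) = (if partial_sum \<alpha> (rho_sharp \<alpha>) (Suc n) \<le> 0 then 1 else -1)"
  by (simp add: partial_sum_def)

declare rho_sharp.simps(2)[simp del]

text \<open>After a zero of the partial sums the sequence starts afresh: up to the factor
  \<open>\<alpha> ^ n * \<rho> n\<close>, its partial sums are those of \<open>rho_sharp\<close>,
  and nonzero ones force the next digit. The case \<open>n = 0\<close> serves the dichotomy's first
  case, block boundaries the second.\<close>

lemma step_condition_block:
  assumes "\<alpha> > 0" "sign_seq \<rho>" "step_condition \<alpha> \<rho>" "partial_sum \<alpha> \<rho> n = 0"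
    and "\<And>i. 0 < i \<Longrightarrow> i \<le> j \<Longrightarrow> partial_sum \<alpha> (rho_sharp \<alpha>) i \<noteq> 0"
  shows "\<rho> (n + j) = \<rho> n * rho_sharp \<alpha> j"
  using assms(5)
proof (induction j rule: less_induct)
  case (less j)
  let ?\<sigma> = "rho_sharp \<alpha>"
  show ?case
  proof (cases j)
    case (Suc i)
    have eq: "\<rho> (n + l) = \<rho> n * ?\<sigma> l" if "l < j" for l
      using less that by auto
    have "partial_sum \<alpha> \<rho> (n + k) = \<alpha> ^ n * \<rho> n * partial_sum \<alpha> ?\<sigma> k" if "k \<le> j" for k
      using that
    proof (induction k)
      case (Suc k)
      then show ?case using eq[of k]
        by (simp add: partial_sum_def algebra_simps power_add)
    qed (use assms(4) in \<open>simp add: partial_sum_def\<close>)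
    then have ps: "partial_sum \<alpha> \<rho> (n + j) = \<alpha> ^ n * (\<rho> n * partial_sum \<alpha> ?\<sigma> j)" by simp
    have "\<rho> (n + j) * partial_sum \<alpha> \<rho> (n + j) \<le> 0"
      using assms(3) by (simp add: step_condition_def)
    then have "\<alpha> ^ n * (\<rho> (n + j) * \<rho> n * partial_sum \<alpha> ?\<sigma> j) \<le> 0"
      unfolding ps by (simp only: mult_ac)
    then have "\<rho> (n + j) * \<rho> n * partial_sum \<alpha> ?\<sigma> j \<le> 0"
      using mult_le_cancel_left_pos[of "\<alpha> ^ n" _ 0] assms(1) by simp
    \<comment> \<open>As this sum is nonzero, the sign is determined and the tie rule of
      \<open>rho_sharp\<close> does not apply.\<close>
    moreover have "partial_sum \<alpha> ?\<sigma> j \<noteq> 0" using less.prems[of j] Suc by auto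
    ultimately show ?thesis
      using sign_seqD[OF assms(2), of n] sign_seqD[OF assms(2), of "n + j"] rho_sharp_Suc[of \<alpha> i]
      unfolding Suc by (auto split: if_splits)
  qed simp
qed

section \<open>Existence, and the case without zeros\<close>

lemma optimal_exists:
  assumes "\<bar>\<alpha>\<bar> < 2"
  shows "\<exists>\<rho>. optimal \<alpha> \<rho>"
proof -
  obtain t where t: "t \<in> maximizers (takagi_landsberg \<alpha>)"
    using maximizers_nonempty[OF continuous_on_takagi_landsberg[OF assms]] by blast
  then have "t \<in> {0..1}" by (simp add: maximizers_def)
  then obtain \<rho> where "rademacher_expansion \<rho> t" using rademacher_expansion_exists by blast
  then show ?thesis using t by (auto simp: optimal_def rademacher_expansion_def)
qed

lemma mem_maximizers_iff:
  "t \<in> maximizers (takagi_landsberg \<alpha>) \<longleftrightarrow> (\<exists>\<rho>. optimal \<alpha> \<rho> \<and> t = rademacher_T \<rho>)"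
  using rademacher_expansion_exists[of t]
  by (auto simp: optimal_def rademacher_expansion_def maximizers_def)

text \<open>The step condition leaves two candidates. Some optimal sequence exists by compactness,
  so one of them is optimal, and the flip at index 0 gives the other; no value of the function is
  computed.\<close>

lemma unique_maximizer_pair:
  assumes "1 / 2 < \<alpha>" "\<alpha> < 2" "\<And>n. 0 < n \<Longrightarrow> partial_sum \<alpha> (rho_sharp \<alpha>) n \<noteq> 0"
  shows "optimal \<alpha> \<rho> \<longleftrightarrow> \<rho> = rho_sharp \<alpha> \<or> \<rho> = (\<lambda>n. - rho_sharp \<alpha> n)"
proof -
  let ?\<sigma> = "rho_sharp \<alpha>"
  have abs2: "\<bar>\<alpha>\<bar> < 2" using assms by simp
  have fwd: "\<rho> = ?\<sigma> \<or> \<rho> = (\<lambda>n. - ?\<sigma> n)" if "optimal \<alpha> \<rho>" for \<rho>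
  proof -
    have sg: "sign_seq \<rho>" using that by (rule optimal_sign_seq)
    have eq: "\<rho> (0 + j) = \<rho> 0 * ?\<sigma> j" for j
    proof (rule step_condition_block)
      show "\<alpha> > 0" using assms(1) by simp
      show "step_condition \<alpha> \<rho>" by (rule optimal_step_condition[OF assms(1,2) that])
      show "partial_sum \<alpha> \<rho> 0 = 0" by (simp add: partial_sum_def)
    qed (use sg assms(3) in blast)+
    have "\<rho> = (\<lambda>j. \<rho> 0 * ?\<sigma> j)"
      by (rule ext) (rule eq[unfolded add_0])
    moreover have "(\<lambda>j. \<rho> 0 * ?\<sigma> j) = ?\<sigma> \<or> (\<lambda>j. \<rho> 0 * ?\<sigma> j) = (\<lambda>n. - ?\<sigma> n)"
      using sign_seqD[OF sg, of 0] by auto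
    ultimately show ?thesis by metis
  qed
  have neg: "flip_from 0 \<rho> = (\<lambda>n. - \<rho> n)" for \<rho>
    by (simp add: flip_from_def fun_eq_iff)
  have flip: "optimal \<alpha> (\<lambda>n. - \<rho> n)" if "optimal \<alpha> \<rho>" for \<rho>
    using optimal_flip_from[OF abs2 that, of 0] by (simp add: partial_sum_def neg)
  obtain \<rho>' where o: "optimal \<alpha> \<rho>'" using optimal_exists[OF abs2] by blast
  have "optimal \<alpha> ?\<sigma>"
  proof (cases "\<rho>' = ?\<sigma>")
    case False
    then have "(\<lambda>n. - \<rho>' n) = ?\<sigma>" using fwd[OF o] by simp
    then show ?thesis using flip[OF o] by simp
  qed (use o in simp)
  then show ?thesis using fwd[of \<rho>] flip[of ?\<sigma>] by blast
qed

lemma maximizers_no_zero: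
  assumes "1 / 2 < \<alpha>" "\<alpha> < 2" "\<And>n. 0 < n \<Longrightarrow> partial_sum \<alpha> (rho_sharp \<alpha>) n \<noteq> 0"
  shows "card (maximizers (takagi_landsberg \<alpha>)) = 2"
    and "maximizers (takagi_landsberg \<alpha>) = {tau_sharp \<alpha>, 1 - tau_sharp \<alpha>}"
    and "{\<rho>. rademacher_expansion \<rho> (tau_sharp \<alpha>)} = {rho_sharp \<alpha>}"
    and "{\<rho>. rademacher_expansion \<rho> (1 - tau_sharp \<alpha>)} = {\<lambda>n. - rho_sharp \<alpha> n}"
proof -
  let ?\<sigma> = "rho_sharp \<alpha>"
  note opt = unique_maximizer_pair[OF assms]
  have T: "rademacher_T ?\<sigma> = tau_sharp \<alpha>" "rademacher_T (\<lambda>n. - ?\<sigma> n) = 1 - tau_sharp \<alpha>"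
    by (simp_all add: tau_sharp_def rademacher_T_uminus sign_seq_rho_sharp)
  show M: "maximizers (takagi_landsberg \<alpha>) = {tau_sharp \<alpha>, 1 - tau_sharp \<alpha>}"
    by (auto simp: set_eq_iff mem_maximizers_iff opt T intro: exI[of _ ?\<sigma>] exI[of _ "\<lambda>n. - ?\<sigma> n"])
  \<comment> \<open>Equality would put the maximizer at 1/2, where the tail sum at 0
    vanishes.\<close>
  have ne: "tau_sharp \<alpha> \<noteq> 1 - tau_sharp \<alpha>"
    using optimal_tail_sum_nonzero[OF assms(1,2), of ?\<sigma> 0] opt
      rademacher_T_eq[OF sign_seq_rho_sharp, of \<alpha>] unfolding T by auto
  show "card (maximizers (takagi_landsberg \<alpha>)) = 2" using ne by (simp add: M)
  \<comment> \<open>Every expansion of a maximizer is itself optimal, hence one of the two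
    candidates. This gives uniqueness of the expansions.\<close>
  have ex: "rademacher_expansion \<rho> t \<longleftrightarrow> (\<rho> = ?\<sigma> \<or> \<rho> = (\<lambda>n. - ?\<sigma> n)) \<and> rademacher_T \<rho> = t"
    if "t \<in> {tau_sharp \<alpha>, 1 - tau_sharp \<alpha>}" for \<rho> t
    using that opt[of \<rho>] M unfolding rademacher_expansion_def optimal_def by blast
  show "{\<rho>. rademacher_expansion \<rho> (tau_sharp \<alpha>)} = {?\<sigma>}"
    using T ne by (auto simp: ex)
  show "{\<rho>. rademacher_expansion \<rho> (1 - tau_sharp \<alpha>)} = {\<lambda>n. - ?\<sigma> n}"
    using T ne by (auto simp: ex)
qed

section \<open>Block structure\<close>

lemma partial_sum_add:
  "partial_sum \<alpha> \<rho> (n + k) = partial_sum \<alpha> \<rho> n + \<alpha> ^ n * partial_sum \<alpha> (\<lambda>j. \<rho> (n + j)) k"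
  by (induction k) (simp_all add: partial_sum_def power_add algebra_simps)

lemma partial_sum_atMost: "(\<Sum>m\<le>n. \<alpha> ^ m * \<rho> m) = partial_sum \<alpha> \<rho> (Suc n)"
  unfolding partial_sum_def lessThan_Suc_atMost ..

lemma partial_sum_cong:
  "(\<And>m. m < n \<Longrightarrow> \<rho> m = \<rho>' m) \<Longrightarrow> partial_sum \<alpha> \<rho> n = partial_sum \<alpha> \<rho>' n"
  by (simp add: partial_sum_def)

lemma partial_sum_scale: "partial_sum \<alpha> (\<lambda>m. c * \<rho> m) n = c * partial_sum \<alpha> \<rho> n"
  by (simp add: partial_sum_def sum_distrib_left mult_ac)

text \<open>Since \<open>\<sigma> 0 = 1\<close>, the sign of a block is its first digit, and the
  disjunction turns into a product.\<close>

lemma signed_blocksD: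
  assumes "signed_blocks \<sigma> n \<rho>" "\<sigma> 0 = 1" "j \<le> n"
  shows "\<rho> (k * (n + 1) + j) = \<rho> (k * (n + 1)) * \<sigma> j"
proof -
  from assms(1)
  have "(\<forall>j\<le>n. \<rho> (k * (n + 1) + j) = \<sigma> j) \<or> (\<forall>j\<le>n. \<rho> (k * (n + 1) + j) = - \<sigma> j)"
    unfolding signed_blocks_def by blast
  then show ?thesis
  proof
    assume h: "\<forall>j\<le>n. \<rho> (k * (n + 1) + j) = \<sigma> j"
    show ?thesis using h[rule_format, of 0] h[rule_format, OF assms(3)] assms(2) by simp
  next
    assume h: "\<forall>j\<le>n. \<rho> (k * (n + 1) + j) = - \<sigma> j"
    show ?thesis using h[rule_format, of 0] h[rule_format, OF assms(3)] assms(2) by simp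
  qed
qed

lemma signed_blocksI:
  assumes "sign_seq \<rho>" "\<And>k j. j \<le> n \<Longrightarrow> \<rho> (k * (n + 1) + j) = \<rho> (k * (n + 1)) * \<sigma> j"
  shows "signed_blocks \<sigma> n \<rho>"
  unfolding signed_blocks_def
proof
  fix k
  show "(\<forall>j\<le>n. \<rho> (k * (n + 1) + j) = \<sigma> j) \<or> (\<forall>j\<le>n. \<rho> (k * (n + 1) + j) = - \<sigma> j)"
    using sign_seqD[OF assms(1), of "k * (n + 1)"]
  proof
    assume h: "\<rho> (k * (n + 1)) = 1"
    show ?thesis using assms(2)[of _ k] unfolding h by simp
  next
    assume h: "\<rho> (k * (n + 1)) = -1"
    show ?thesis using assms(2)[of _ k] unfolding h by simp
  qed
qed

lemma partial_sum_block:
  assumes "partial_sum \<alpha> \<sigma> (Suc n) = 0" "partial_sum \<alpha> \<rho> m = 0"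
    and "\<And>j. j \<le> n \<Longrightarrow> \<rho> (m + j) = c * \<sigma> j"
  shows "partial_sum \<alpha> \<rho> (m + Suc n) = 0"
proof -
  have "partial_sum \<alpha> (\<lambda>j. \<rho> (m + j)) (Suc n) = partial_sum \<alpha> (\<lambda>j. c * \<sigma> j) (Suc n)"
    by (rule partial_sum_cong) (use assms(3) in simp)
  then show ?thesis
    unfolding partial_sum_add assms(2) partial_sum_scale assms(1) by simp
qed

lemma partial_sum_signed_blocks:
  assumes "signed_blocks \<sigma> n \<rho>" "\<sigma> 0 = 1" "partial_sum \<alpha> \<sigma> (Suc n) = 0"
  shows "partial_sum \<alpha> \<rho> (k * (n + 1)) = 0"
proof (induction k)
  case (Suc k)
  have "partial_sum \<alpha> \<rho> (k * (n + 1) + Suc n) = 0"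
    by (rule partial_sum_block[OF assms(3) Suc signed_blocksD[where \<sigma>=\<sigma>]]) (use assms in auto)
  moreover have "k * (n + 1) + Suc n = Suc k * (n + 1)" by simp
  ultimately show ?case by (simp only:)
qed (simp add: partial_sum_def)

text \<open>Induction over blocks: each block returns the partial sum to zero, which is what
  \<open>step_condition_block\<close> needs to determine the next one.\<close>

lemma step_condition_signed_blocks:
  assumes "\<alpha> > 0" "sign_seq \<rho>" "step_condition \<alpha> \<rho>"
    and "partial_sum \<alpha> (rho_sharp \<alpha>) (Suc n) = 0"
    and "\<And>i. 0 < i \<Longrightarrow> i \<le> n \<Longrightarrow> partial_sum \<alpha> (rho_sharp \<alpha>) i \<noteq> 0"
  shows "signed_blocks (rho_sharp \<alpha>) n \<rho>"
proof -
  have blk: "\<rho> (m + j) = \<rho> m * rho_sharp \<alpha> j"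
    if "partial_sum \<alpha> \<rho> m = 0" "j \<le> n" for m j
    by (rule step_condition_block[OF assms(1-3) that(1)]) (use assms(5) that(2) in simp)
  have ps: "partial_sum \<alpha> \<rho> (k * (n + 1)) = 0" for k
  proof (induction k)
    case (Suc k)
    have "partial_sum \<alpha> \<rho> (k * (n + 1) + Suc n) = 0"
      by (rule partial_sum_block[OF assms(4) Suc blk[OF Suc]])
    moreover have "k * (n + 1) + Suc n = Suc k * (n + 1)" by simp
    ultimately show ?case by (simp only:)
  qed (simp add: partial_sum_def)
  show ?thesis by (rule signed_blocksI[OF assms(2) blk[OF ps]])
qed

text \<open>Any optimal sequence can be corrected block by block. Partial sums vanish at block
  boundaries, so flipping there keeps optimality, and it does not disturb the blocks already
  matched.\<close>

lemma signed_blocks_optimal_approx: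
  assumes "1 / 2 < \<alpha>" "\<alpha> < 2" "sign_seq \<rho>" "signed_blocks (rho_sharp \<alpha>) n \<rho>"
    and "partial_sum \<alpha> (rho_sharp \<alpha>) (Suc n) = 0"
    and "\<And>i. 0 < i \<Longrightarrow> i \<le> n \<Longrightarrow> partial_sum \<alpha> (rho_sharp \<alpha>) i \<noteq> 0"
  shows "\<exists>\<rho>'. optimal \<alpha> \<rho>' \<and> (\<forall>i < k * (n + 1). \<rho>' i = \<rho> i)"
proof (induction k)
  case 0
  show ?case using optimal_exists[of \<alpha>] assms(1,2) by auto
next
  case (Suc k)
  define m where "m = k * (n + 1)"
  have abs2: "\<bar>\<alpha>\<bar> < 2" using assms by simp
  have s0: "rho_sharp \<alpha> 0 = 1" by simp
  obtain \<rho>' where o: "optimal \<alpha> \<rho>'" and eq: "\<forall>i < m. \<rho>' i = \<rho> i" using Suc unfolding m_def by blast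
  have sg: "sign_seq \<rho>'" using o by (rule optimal_sign_seq)
  have sb: "signed_blocks (rho_sharp \<alpha>) n \<rho>'"
    by (rule step_condition_signed_blocks[OF _ sg optimal_step_condition[OF assms(1,2) o]])
      (use assms in auto)
  have ps: "partial_sum \<alpha> \<rho>' m = 0"
    unfolding m_def by (rule partial_sum_signed_blocks[where \<sigma>="rho_sharp \<alpha>"]) (use sb s0 assms(5) in auto)
  have fl: "optimal \<alpha> (flip_from m \<rho>')"
    by (rule optimal_flip_from[OF abs2 o]) (simp only: ps mult_zero_right)
  have split: "i < m \<or> (\<exists>j\<le>n. i = m + j)" if "i < Suc k * (n + 1)" for i
    using that unfolding m_def[symmetric] mult_Suc
    by (cases "i < m") (auto intro!: exI[of _ "i - m"])
  have b: "\<rho> (m + j) = \<rho> m * rho_sharp \<alpha> j" "\<rho>' (m + j) = \<rho>' m * rho_sharp \<alpha> j"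
    if "j \<le> n" for j
    unfolding m_def by (rule signed_blocksD; use that assms(4) sb s0 in blast)+
  show ?case
  proof (cases "\<rho>' m = \<rho> m")
    case True
    have "\<rho>' i = \<rho> i" if "i < Suc k * (n + 1)" for i
      using split[OF that] eq b True by auto
    then show ?thesis using o by blast
  next
    case False
    then have opp: "- \<rho>' m = \<rho> m"
      using sign_seqD[OF sg, of m] sign_seqD[OF assms(3), of m] by auto
    have "flip_from m \<rho>' i = \<rho> i" if i: "i < Suc k * (n + 1)" for i
    proof (cases "i < m")
      case True
      then show ?thesis using eq by (simp add: flip_from_def)
    next
      case False
      then obtain j where j: "j \<le> n" "i = m + j" using split[OF i] by auto
      have "flip_from m \<rho>' i = - \<rho>' m * rho_sharp \<alpha> j"
        using j b(2)[OF j(1)] by (simp add: flip_from_def)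
      also have "\<dots> = \<rho> i" unfolding opp j(2) b(1)[OF j(1)] ..
      finally show ?thesis .
    qed
    then show ?thesis using fl by blast
  qed
qed

lemma optimal_iff_signed_blocks:
  assumes "1 / 2 < \<alpha>" "\<alpha> < 2" "partial_sum \<alpha> (rho_sharp \<alpha>) (Suc n) = 0"
    and "\<And>i. 0 < i \<Longrightarrow> i \<le> n \<Longrightarrow> partial_sum \<alpha> (rho_sharp \<alpha>) i \<noteq> 0"
  shows "optimal \<alpha> \<rho> \<longleftrightarrow> sign_seq \<rho> \<and> signed_blocks (rho_sharp \<alpha>) n \<rho>"
proof
  assume o: "optimal \<alpha> \<rho>"
  have sg: "sign_seq \<rho>" using o by (rule optimal_sign_seq)
  show "sign_seq \<rho> \<and> signed_blocks (rho_sharp \<alpha>) n \<rho>"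
    using step_condition_signed_blocks[OF _ sg optimal_step_condition[OF assms(1,2) o] assms(3,4)]
      sg assms(1) by simp
next
  assume h: "sign_seq \<rho> \<and> signed_blocks (rho_sharp \<alpha>) n \<rho>"
  have "\<exists>\<rho>'. optimal \<alpha> \<rho>' \<and> (\<forall>i < k * (n + 1). \<rho>' i = \<rho> i)" for k
    by (rule signed_blocks_optimal_approx) (use assms h in auto)
  then obtain R where R: "\<And>k. optimal \<alpha> (R k)" "\<And>k i. i < k * (n + 1) \<Longrightarrow> R k i = \<rho> i"
    by metis
  have "(\<lambda>k. rademacher_T (R k)) \<longlonglongrightarrow> rademacher_T \<rho>"
  proof (rule LIM_zero_cancel, rule Lim_null_comparison)
    show "\<forall>\<^sub>F k in sequentially. norm (rademacher_T (R k) - rademacher_T \<rho>) \<le> (1/2) ^ k"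
    proof (rule always_eventually, rule allI)
      fix k
      \<comment> \<open>The \<open>k * (n + 1)\<close> common digits include the first
        \<open>k\<close>, which is enough for convergence; closedness then carries optimality to the
        limit.\<close>
      have "\<bar>rademacher_T (R k) - rademacher_T \<rho>\<bar> \<le> 1 / 2 ^ k"
        by (rule rademacher_T_close) (use h R(2)[of _ k] optimal_sign_seq[OF R(1)] in auto)
      then show "norm (rademacher_T (R k) - rademacher_T \<rho>) \<le> (1/2) ^ k"
        by (simp add: power_divide)
    qed
    show "(\<lambda>k. (1/2::real) ^ k) \<longlonglongrightarrow> 0" by (rule LIMSEQ_realpow_zero) auto
  qed
  moreover have "closed (maximizers (takagi_landsberg \<alpha>))"
    using assms(1,2) by (intro closed_maximizers continuous_on_takagi_landsberg) simp
  moreover have "\<And>k. rademacher_T (R k) \<in> maximizers (takagi_landsberg \<alpha>)"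
    using R(1) by (simp add: optimal_def)
  ultimately have "rademacher_T \<rho> \<in> maximizers (takagi_landsberg \<alpha>)"
    by (metis closed_sequentially)
  then show "optimal \<alpha> \<rho>" using h by (simp add: optimal_def)
qed

section \<open>The Cantor set of signed geometric series\<close>

text \<open>For \<open>r = 1/2\<close> this is \<open>tail_sum \<eta> 0\<close>; for
  \<open>r \<le> 1/4\<close> different sign sequences give different values.\<close>

definition power_sum :: "real \<Rightarrow> (nat \<Rightarrow> real) \<Rightarrow> real" where
  "power_sum r \<eta> = (\<Sum>k. \<eta> k * r ^ k)"

text \<open>Each block contributes its sign times one fixed weight, so grouping digits by blocks
  leaves a signed series in powers of \<open>1 / 2 ^ (n + 1)\<close>.\<close>

lemma tail_sum_signed_blocks:
  assumes "sign_seq \<rho>" "\<sigma> 0 = 1" "signed_blocks \<sigma> n \<rho>"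
  shows "tail_sum \<rho> 0 = (\<Sum>j\<le>n. \<sigma> j / 2 ^ j) * power_sum ((1/2) ^ (n + 1)) (\<lambda>k. \<rho> (k * (n + 1)))"
proof -
  let ?A = "\<Sum>j\<le>n. \<sigma> j / 2 ^ j" and ?r = "(1/2::real) ^ (n + 1)"
  let ?\<eta> = "\<lambda>k. \<rho> (k * (n + 1))"
  have step: "tail_sum \<rho> (k * (n + 1)) = ?\<eta> k * ?A + ?r * tail_sum \<rho> (Suc k * (n + 1))" for k
  proof -
    have "(\<Sum>j<Suc n. \<rho> (k * (n + 1) + j) / 2 ^ j) = (\<Sum>j<Suc n. ?\<eta> k * (\<sigma> j / 2 ^ j))"
    proof (rule sum.cong)
      fix j assume "j \<in> {..<Suc n}"
      then have "\<rho> (k * (n + 1) + j) = ?\<eta> k * \<sigma> j"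
        by (intro signed_blocksD[where \<sigma>=\<sigma>]) (use assms in auto)
      then show "\<rho> (k * (n + 1) + j) / 2 ^ j = ?\<eta> k * (\<sigma> j / 2 ^ j)"
        by (simp only: times_divide_eq_right)
    qed simp
    also have "\<dots> = ?\<eta> k * ?A" by (simp only: sum_distrib_left[symmetric] lessThan_Suc_atMost)
    finally have "tail_sum \<rho> (k * (n + 1)) = ?\<eta> k * ?A + tail_sum \<rho> (k * (n + 1) + Suc n) / 2 ^ Suc n"
      using tail_sum_split[OF assms(1), of "k * (n + 1)" "Suc n"] by (simp only:)
    moreover have "k * (n + 1) + Suc n = Suc k * (n + 1)" by simp
    ultimately show ?thesis by (simp only:) (simp add: power_divide)
  qed
  \<comment> \<open>Regrouping is done with finite sums and a vanishing remainder.\<close>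
  have part: "tail_sum \<rho> 0 = (\<Sum>k<K. ?\<eta> k * ?r ^ k * ?A) + ?r ^ K * tail_sum \<rho> (K * (n + 1))" for K
  proof (induction K)
    case (Suc K)
    show ?case
      unfolding Suc step[of K] sum.lessThan_Suc power_Suc by (simp only: algebra_simps)
  qed simp
  have "(\<lambda>K. ?r ^ K * tail_sum \<rho> (K * (n + 1))) \<longlonglongrightarrow> 0"
  proof (rule Lim_null_comparison)
    show "\<forall>\<^sub>F K in sequentially. norm (?r ^ K * tail_sum \<rho> (K * (n + 1))) \<le> ?r ^ K * 2"
      by (intro always_eventually allI)
        (simp only: real_norm_def abs_mult, intro mult_mono abs_tail_sum_le assms, simp_all)
    have "?r < 1" by (rule power_Suc_less_one[of "1/2::real" n, simplified Suc_eq_plus1]) auto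
    then have "(\<lambda>K. ?r ^ K) \<longlonglongrightarrow> 0" by (intro LIMSEQ_realpow_zero) auto
    then show "(\<lambda>K. ?r ^ K * 2) \<longlonglongrightarrow> 0" by (rule tendsto_mult_left_zero)
  qed
  then have "(\<lambda>K. tail_sum \<rho> 0 - ?r ^ K * tail_sum \<rho> (K * (n + 1))) \<longlonglongrightarrow> tail_sum \<rho> 0 - 0"
    by (intro tendsto_diff tendsto_const)
  moreover have "tail_sum \<rho> 0 - ?r ^ K * tail_sum \<rho> (K * (n + 1)) = (\<Sum>k<K. ?\<eta> k * ?r ^ k * ?A)" for K
    using part[of K] by linarith
  ultimately have "(\<lambda>k. ?\<eta> k * ?r ^ k * ?A) sums tail_sum \<rho> 0"
    unfolding sums_def by (simp only: diff_zero)
  moreover have "(\<lambda>k. ?\<eta> k * ?r ^ k * ?A) sums (power_sum ?r ?\<eta> * ?A)"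
    unfolding power_sum_def
  proof (intro sums_mult2 summable_sums sign_seq_summable_power)
    show "sign_seq ?\<eta>" using assms(1) by (simp add: sign_seq_def)
    show "\<bar>?r\<bar> < 1" using power_Suc_less_one[of "1/2::real" n] by simp
  qed
  ultimately show ?thesis unfolding mult.commute[of "\<Sum>j\<le>n. \<sigma> j / 2 ^ j"] by (rule sums_unique2)
qed

text \<open>The worst case has only digits -1 after the first: 1 - 1/2 - ... -
  \<open>1 / 2 ^ n\<close> = \<open>1 / 2 ^ n\<close>. Hence the scaling factor of the Cantor set is
  nonzero.\<close>

lemma block_weight_pos:
  assumes "sign_seq \<sigma>" "\<sigma> 0 = 1"
  shows "(\<Sum>j\<le>n. \<sigma> j / 2 ^ j) \<ge> 1 / 2 ^ n"
proof (induction n)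
  case (Suc n)
  have "\<sigma> (Suc n) / 2 ^ Suc n \<ge> - 1 / 2 ^ Suc n"
    using sign_seqD[OF assms(1), of "Suc n"] by (intro divide_right_mono) auto
  with Suc show ?case by simp
qed (use assms in simp)

text \<open>For \<open>c = 0\<close>, \<open>a = 1\<close> and \<open>\<bar>r\<bar> < 1\<close> this
  set \<open>P\<close> satisfies \<open>P = (-1 + r * P) \<union> (1 + r * P)\<close>: it is
  self-similar with two pieces of ratio \<open>r\<close>.\<close>

definition sign_cantor_set :: "real \<Rightarrow> real \<Rightarrow> real \<Rightarrow> real set" where
  "sign_cantor_set c a r = {c + a * power_sum r \<eta> |\<eta>. sign_seq \<eta>}"

text \<open>Shows that every sequence of block signs occurs.\<close>

lemma sign_seq_of_blocks:
  fixes n :: nat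
  assumes "sign_seq \<eta>" "sign_seq \<sigma>" "\<sigma> 0 = 1"
  defines "\<rho> \<equiv> \<lambda>m. \<eta> (m div (n + 1)) * \<sigma> (m mod (n + 1))"
  shows "sign_seq \<rho>" "signed_blocks \<sigma> n \<rho>" "\<rho> (k * (n + 1)) = \<eta> k"
proof -
  show sg: "sign_seq \<rho>"
    unfolding sign_seq_def \<rho>_def
  proof
    show "\<eta> (m div (n + 1)) * \<sigma> (m mod (n + 1)) \<in> {-1, 1}" for m
      using sign_seqD[OF assms(1), of "m div (n + 1)"] sign_seqD[OF assms(2), of "m mod (n + 1)"]
      by auto
  qed
  have b: "\<rho> (k * (n + 1) + j) = \<eta> k * \<sigma> j" if "j \<le> n" for k j
  proof -
    have "(k * (n + 1) + j) div (n + 1) = k" using that by (intro div_nat_eqI) auto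
    moreover have "(k * (n + 1) + j) mod (n + 1) = j" using that by (subst mod_mult_self3) auto
    ultimately show ?thesis by (simp only: \<rho>_def)
  qed
  have b0: "\<rho> (k * (n + 1)) = \<eta> k" for k using b[of 0 k] assms(3) by simp
  show "signed_blocks \<sigma> n \<rho>"
    by (rule signed_blocksI[OF sg]) (simp only: b b0)
  show "\<rho> (k * (n + 1)) = \<eta> k" by (rule b0)
qed

lemma signed_blocks_sign_cantor_set:
  assumes "sign_seq \<sigma>" "\<sigma> 0 = 1"
  shows "{rademacher_T \<rho> |\<rho>. sign_seq \<rho> \<and> signed_blocks \<sigma> n \<rho>}
    = sign_cantor_set (1/2) (- (\<Sum>j\<le>n. \<sigma> j / 2 ^ j) / 4) ((1/2) ^ (n + 1))"
proof -
  have T: "rademacher_T \<rho> = 1/2 + - (\<Sum>j\<le>n. \<sigma> j / 2 ^ j) / 4 *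
      power_sum ((1/2) ^ (n + 1)) (\<lambda>k. \<rho> (k * (n + 1)))"
    if "sign_seq \<rho>" "signed_blocks \<sigma> n \<rho>" for \<rho>
    unfolding rademacher_T_eq[OF that(1)] tail_sum_signed_blocks[OF that(1) assms(2) that(2)] by simp
  show ?thesis
  proof (intro set_eqI iffI)
    fix t assume "t \<in> {rademacher_T \<rho> |\<rho>. sign_seq \<rho> \<and> signed_blocks \<sigma> n \<rho>}"
    then obtain \<rho> where \<rho>: "sign_seq \<rho>" "signed_blocks \<sigma> n \<rho>" "t = rademacher_T \<rho>" by blast
    moreover have "sign_seq (\<lambda>k. \<rho> (k * (n + 1)))" using \<rho>(1) by (simp add: sign_seq_def)
    ultimately show "t \<in> sign_cantor_set (1/2) (- (\<Sum>j\<le>n. \<sigma> j / 2 ^ j) / 4) ((1/2) ^ (n + 1))"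
      unfolding sign_cantor_set_def using T[OF \<rho>(1,2)] by blast
  next
    fix t assume "t \<in> sign_cantor_set (1/2) (- (\<Sum>j\<le>n. \<sigma> j / 2 ^ j) / 4) ((1/2) ^ (n + 1))"
    then obtain \<eta> where \<eta>: "sign_seq \<eta>"
      and t: "t = 1/2 + - (\<Sum>j\<le>n. \<sigma> j / 2 ^ j) / 4 * power_sum ((1/2) ^ (n + 1)) \<eta>"
      unfolding sign_cantor_set_def by blast
    define \<rho> where "\<rho> m = \<eta> (m div (n + 1)) * \<sigma> (m mod (n + 1))" for m
    have \<rho>: "sign_seq \<rho>" "signed_blocks \<sigma> n \<rho>" "\<And>k. \<rho> (k * (n + 1)) = \<eta> k"
      unfolding \<rho>_def by (rule sign_seq_of_blocks[OF \<eta> assms])+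
    have "t = rademacher_T \<rho>" unfolding T[OF \<rho>(1,2)] \<rho>(3) by (rule t)
    then show "t \<in> {rademacher_T \<rho> |\<rho>. sign_seq \<rho> \<and> signed_blocks \<sigma> n \<rho>}"
      using \<rho>(1,2) by blast
  qed
qed

section \<open>Distances between signed power sums\<close>

lemma power_sum_split:
  assumes "sign_seq \<eta>" "\<bar>r\<bar> < 1"
  shows "power_sum r \<eta> = (\<Sum>k<n. \<eta> k * r ^ k) + r ^ n * power_sum r (\<lambda>k. \<eta> (n + k))"
proof -
  have "power_sum r \<eta> = (\<Sum>k. \<eta> (k + n) * r ^ (k + n)) + (\<Sum>k<n. \<eta> k * r ^ k)"
    unfolding power_sum_def
    by (rule suminf_split_initial_segment[OF sign_seq_summable_power[OF assms]])
  also have "(\<Sum>k. \<eta> (k + n) * r ^ (k + n)) = (\<Sum>k. r ^ n * (\<eta> (n + k) * r ^ k))"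
    by (simp add: power_add mult_ac add.commute)
  also have "\<dots> = r ^ n * power_sum r (\<lambda>k. \<eta> (n + k))"
    unfolding power_sum_def
    by (rule suminf_mult[OF sign_seq_summable_power[OF sign_seq_shift[OF assms(1)] assms(2)]])
  finally show ?thesis by simp
qed

lemma abs_power_sum_le:
  assumes "sign_seq \<eta>" "0 < r" "r < 1"
  shows "\<bar>power_sum r \<eta>\<bar> \<le> 1 / (1 - r)"
proof -
  have eq: "\<bar>\<eta> k * r ^ k\<bar> = r ^ k" for k
    using sign_seq_abs[OF assms(1)] assms(2) by (simp add: abs_mult)
  have "\<bar>power_sum r \<eta>\<bar> \<le> (\<Sum>k. \<bar>\<eta> k * r ^ k\<bar>)"
    unfolding power_sum_def
    by (rule summable_rabs) (use assms in \<open>simp only: eq, simp add: summable_geometric\<close>)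
  also have "\<dots> = 1 / (1 - r)"
    unfolding eq by (rule suminf_geometric) (use assms in simp)
  finally show ?thesis .
qed

text \<open>After the common prefix each tail is at most 4/3 in absolute value, and 8/3 \<le>
  3.\<close>

lemma power_sum_diff_le:
  assumes "sign_seq \<eta>" "sign_seq \<eta>'" "0 < r" "r \<le> 1/4" "\<And>k. k < n \<Longrightarrow> \<eta> k = \<eta>' k"
  shows "\<bar>power_sum r \<eta> - power_sum r \<eta>'\<bar> \<le> 3 * r ^ n"
proof -
  let ?d = "power_sum r (\<lambda>k. \<eta> (n + k)) - power_sum r (\<lambda>k. \<eta>' (n + k))"
  have "1 / (1 - r) \<le> 4 / 3" using assms(3,4) by (simp add: field_simps)
  then have d: "\<bar>?d\<bar> \<le> 3"
    using abs_power_sum_le[OF sign_seq_shift[OF assms(1)], of r n]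
      abs_power_sum_le[OF sign_seq_shift[OF assms(2)], of r n] assms(3,4) by linarith
  have "power_sum r \<eta> - power_sum r \<eta>' = ?d * r ^ n"
    using power_sum_split[OF assms(1), of r n] power_sum_split[OF assms(2), of r n] assms(3-5)
    by (simp add: algebra_simps)
  then have "\<bar>power_sum r \<eta> - power_sum r \<eta>'\<bar> = \<bar>?d\<bar> * r ^ n"
    using assms(3) by (simp add: abs_mult)
  then show ?thesis using d assms(3) by (simp add: mult_right_mono)
qed

text \<open>The digits at \<open>n\<close> differ by 2, and the later ones shift each side by at
  most 1/3, leaving at least 4/3. So the pieces of the Cantor set are separated on the scale of
  their size.\<close>

lemma power_sum_diff_ge:
  assumes "sign_seq \<eta>" "sign_seq \<eta>'" "0 < r" "r \<le> 1/4"
    and "\<And>k. k < n \<Longrightarrow> \<eta> k = \<eta>' k" "\<eta> n \<noteq> \<eta>' n"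
  shows "\<bar>power_sum r \<eta> - power_sum r \<eta>'\<bar> \<ge> r ^ n"
proof -
  let ?t = "\<lambda>\<eta>. power_sum r (\<lambda>k. \<eta> (n + k))"
  have "1 / (1 - r) \<le> 4 / 3" using assms(3,4) by (simp add: field_simps)
  then have b: "\<bar>power_sum r (\<lambda>k. \<eta> (Suc n + k))\<bar> \<le> 4 / 3"
    if "sign_seq \<eta>" for \<eta>
    using abs_power_sum_le[OF sign_seq_shift[OF that], of r "Suc n"] assms(3,4) by linarith
  have rb: "\<bar>r * power_sum r (\<lambda>k. \<eta> (Suc n + k))\<bar> \<le> 1 / 3" if "sign_seq \<eta>" for \<eta>
  proof -
    have "\<bar>r * power_sum r (\<lambda>k. \<eta> (Suc n + k))\<bar> \<le> 1/4 * (4/3)"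
      unfolding abs_mult by (rule mult_mono) (use b[OF that] assms(3,4) in auto)
    then show ?thesis by simp
  qed
  have t: "?t \<eta> = \<eta> n + r * power_sum r (\<lambda>k. \<eta> (Suc n + k))" if "sign_seq \<eta>" for \<eta>
    using power_sum_split[OF sign_seq_shift[OF that], of r n 1] assms(3,4) by simp
  have "\<bar>\<eta> n - \<eta>' n\<bar> = 2"
    using assms(6) sign_seqD[OF assms(1), of n] sign_seqD[OF assms(2), of n] by auto
  then have d: "\<bar>?t \<eta> - ?t \<eta>'\<bar> \<ge> 1"
    unfolding t[OF assms(1)] t[OF assms(2)] using rb[OF assms(1)] rb[OF assms(2)] by linarith
  have "power_sum r \<eta> - power_sum r \<eta>' = (?t \<eta> - ?t \<eta>') * r ^ n"
    using power_sum_split[OF assms(1), of r n] power_sum_split[OF assms(2), of r n] assms(3-5)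
    by (simp add: algebra_simps)
  then have "\<bar>power_sum r \<eta> - power_sum r \<eta>'\<bar> = \<bar>?t \<eta> - ?t \<eta>'\<bar> * r ^ n"
    using assms(3) by (simp add: abs_mult)
  then show ?thesis using mult_right_mono[OF d, of "r ^ n"] assms(3) by simp
qed

lemma sign_cantor_set_not_isolated:
  assumes "a \<noteq> 0" "0 < r" "r \<le> 1/4"
  shows "\<not> x isolated_in sign_cantor_set c a r"
proof
  assume "x isolated_in sign_cantor_set c a r"
  then obtain U where x: "x \<in> sign_cantor_set c a r" and U: "open U" "U \<inter> sign_cantor_set c a r = {x}"
    unfolding isolated_in_def by blast
  from x obtain \<eta> where \<eta>: "sign_seq \<eta>" "x = c + a * power_sum r \<eta>"
    unfolding sign_cantor_set_def by blast
  have "x \<in> U" using U by blast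
  then obtain e where e: "e > 0" "ball x e \<subseteq> U" using U(1) open_contains_ball by blast
  have "(\<lambda>n. \<bar>a\<bar> * (3 * r ^ n)) \<longlonglongrightarrow> \<bar>a\<bar> * (3 * 0)"
    by (intro tendsto_intros LIMSEQ_realpow_zero) (use assms in auto)
  then have "\<forall>\<^sub>F n in sequentially. \<bar>a\<bar> * (3 * r ^ n) < e"
    by (rule order_tendstoD(2)) (use e in simp)
  then obtain n where n: "\<bar>a\<bar> * (3 * r ^ n) < e" by (auto simp: eventually_sequentially)
  \<comment> \<open>Changing one sufficiently late digit yields a different point within distance
    \<open>e\<close>.\<close>
  define \<eta>' where "\<eta>' = \<eta>(n := - \<eta> n)"
  have \<eta>': "sign_seq \<eta>'" using \<eta>(1) sign_seqD[OF \<eta>(1), of n] by (auto simp: sign_seq_def \<eta>'_def)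
  have agree: "\<And>k. k < n \<Longrightarrow> \<eta> k = \<eta>' k" by (simp add: \<eta>'_def)
  have neq: "\<eta> n \<noteq> \<eta>' n" using sign_seqD[OF \<eta>(1), of n] by (auto simp: \<eta>'_def)
  define y where "y = c + a * power_sum r \<eta>'"
  have xy: "\<bar>x - y\<bar> = \<bar>a\<bar> * \<bar>power_sum r \<eta> - power_sum r \<eta>'\<bar>"
    by (simp add: \<eta>(2) y_def flip: abs_mult right_diff_distrib)
  have "\<bar>x - y\<bar> \<le> \<bar>a\<bar> * (3 * r ^ n)"
    unfolding xy using power_sum_diff_le[OF \<eta>(1) \<eta>' assms(2,3) agree] by (simp add: mult_left_mono)
  then have "y \<in> U" using n e(2) by (auto simp: subset_iff dist_real_def)
  moreover have "y \<in> sign_cantor_set c a r" unfolding sign_cantor_set_def y_def using \<eta>' by blast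
  moreover have "r ^ n > 0" using assms(2) by simp
  then have "\<bar>x - y\<bar> > 0"
    unfolding xy using power_sum_diff_ge[OF \<eta>(1) \<eta>' assms(2,3) agree neq] assms(1)
    by (intro mult_pos_pos) auto
  ultimately show False using U(2) by auto
qed

section \<open>Hausdorff measure of the Cantor set\<close>

text \<open>Numbers the cylinders of level \<open>n\<close>, because covers in
  \<open>hausdorff_premeasure\<close> are sequences of sets.\<close>

lemma sign_prefixes:
  "\<exists>p :: nat \<Rightarrow> nat \<Rightarrow> real. \<forall>\<eta>. sign_seq \<eta> \<longrightarrow> (\<exists>i<2 ^ n. \<forall>k<n. p i k = \<eta> k)"
proof (induction n)
  case (Suc n)
  then obtain p :: "nat \<Rightarrow> nat \<Rightarrow> real"
    where p: "\<And>\<eta>. sign_seq \<eta> \<Longrightarrow> \<exists>i<2 ^ n. \<forall>k<n. p i k = \<eta> k" by blast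
  define q where "q i = (if i < 2 ^ n then (p i)(n := 1) else (p (i - 2 ^ n))(n := -1))" for i
  have "\<exists>i<2 ^ Suc n. \<forall>k<Suc n. q i k = \<eta> k" if sg: "sign_seq \<eta>" for \<eta>
  proof -
    obtain i where i: "i < 2 ^ n" "\<forall>k<n. p i k = \<eta> k" using p[OF sg] by blast
    show ?thesis using sign_seqD[OF sg, of n]
    proof
      assume "\<eta> n = 1"
      then have "\<forall>k<Suc n. q i k = \<eta> k" using i by (auto simp: q_def less_Suc_eq)
      moreover have "i < 2 ^ Suc n" using i(1) by simp
      ultimately show ?thesis by blast
    next
      assume "\<eta> n = -1"
      then have "\<forall>k<Suc n. q (2 ^ n + i) k = \<eta> k" using i by (auto simp: q_def less_Suc_eq)
      moreover have "2 ^ n + i < 2 ^ Suc n" using i(1) by simp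
      ultimately show ?thesis by blast
    qed
  qed
  then show ?case by blast
qed auto

text \<open>The cover consists of the \<open>2 ^ n\<close> cylinders of level \<open>n\<close>,
  padded with empty sets, which contribute 0.\<close>

lemma hausdorff_premeasure_sign_cantor_set_le:
  assumes "0 < t" "0 < r" "r \<le> 1/4" "\<bar>a\<bar> * (3 * r ^ n) \<le> \<delta>"
  shows "hausdorff_premeasure t \<delta> (sign_cantor_set c a r) \<le> ennreal (2 ^ n * (\<bar>a\<bar> * (3 * r ^ n)) powr t)"
proof -
  define D where "D = \<bar>a\<bar> * (3 * r ^ n)"
  have D0: "D \<ge> 0" using assms(2) by (simp add: D_def)
  obtain p :: "nat \<Rightarrow> nat \<Rightarrow> real"
    where p: "\<And>\<eta>. sign_seq \<eta> \<Longrightarrow> \<exists>i<2 ^ n. \<forall>k<n. p i k = \<eta> k"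
    using sign_prefixes[of n] by blast
  define U where "U i = (if i < 2 ^ n then {c + a * power_sum r \<eta> |\<eta>. sign_seq \<eta> \<and> (\<forall>k<n. p i k = \<eta> k)}
      else {})" for i
  have d: "\<bar>x - y\<bar> \<le> D" if "x \<in> U i" "y \<in> U i" for x y i
  proof -
    have "i < 2 ^ n" using that(1) by (auto simp: U_def split: if_splits)
    then have "U i = {c + a * power_sum r \<eta> |\<eta>. sign_seq \<eta> \<and> (\<forall>k<n. p i k = \<eta> k)}"
      by (simp add: U_def)
    with that obtain \<eta> \<eta>' where \<eta>: "sign_seq \<eta>" "\<forall>k<n. p i k = \<eta> k" "x = c + a * power_sum r \<eta>"
      and \<eta>': "sign_seq \<eta>'" "\<forall>k<n. p i k = \<eta>' k" "y = c + a * power_sum r \<eta>'"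
      by blast
    have "\<bar>x - y\<bar> = \<bar>a\<bar> * \<bar>power_sum r \<eta> - power_sum r \<eta>'\<bar>"
      by (simp add: \<eta>(3) \<eta>'(3) flip: abs_mult right_diff_distrib)
    also have "\<dots> \<le> \<bar>a\<bar> * (3 * r ^ n)"
      by (intro mult_left_mono power_sum_diff_le) (use \<eta> \<eta>' assms in auto)
    finally show ?thesis by (simp add: D_def)
  qed
  have diam: "diameter (U i) \<le> D" for i
    by (rule diameter_le) (use D0 d in auto)
  have bdd: "bounded (U i)" for i
    unfolding bounded_two_points using d[of _ i] by (auto simp: dist_real_def)
  have pw: "diam_power t (U i) \<le> (if i < 2 ^ n then ennreal (D powr t) else 0)" for i
  proof (cases "U i = {}")
    case False
    then have "i < 2 ^ n" by (auto simp: U_def split: if_splits)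
    moreover have "diameter (U i) powr t \<le> D powr t"
      by (rule powr_mono2) (use assms(1) diam diameter_ge_0[OF bdd] in auto)
    ultimately show ?thesis using False assms(1) by (simp add: diam_power_def ennreal_leI)
  qed (simp add: diam_power_def)
  have "sign_cantor_set c a r \<subseteq> (\<Union>i. U i)"
  proof
    fix x assume "x \<in> sign_cantor_set c a r"
    then obtain \<eta> where \<eta>: "sign_seq \<eta>" "x = c + a * power_sum r \<eta>"
      unfolding sign_cantor_set_def by blast
    obtain i where "i < 2 ^ n" "\<forall>k<n. p i k = \<eta> k" using p[OF \<eta>(1)] by blast
    then have "x \<in> U i" using \<eta> by (auto simp: U_def)
    then show "x \<in> (\<Union>i. U i)" by blast
  qed
  moreover have "diameter (U i) \<le> \<delta>" for i using diam[of i] assms(4) by (simp add: D_def)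
  ultimately have "hausdorff_premeasure t \<delta> (sign_cantor_set c a r) \<le> (\<Sum>i. diam_power t (U i))"
    unfolding hausdorff_premeasure_def using bdd by (intro INF_lower) auto
  also have "\<dots> \<le> (\<Sum>i. if i < 2 ^ n then ennreal (D powr t) else 0)"
    by (intro suminf_le pw) auto
  also have "\<dots> = (\<Sum>i<(2::nat) ^ n. ennreal (D powr t))"
    by (subst suminf_finite[of "{..<2 ^ n}"]) auto
  also have "\<dots> = ennreal (2 ^ n * D powr t)"
    by (simp add: ennreal_mult' ennreal_power flip: ennreal_numeral)
  finally show ?thesis by (simp add: D_def)
qed

text \<open>Sending a point of the Cantor set to the real number with the same signs as Rademacher
  expansion is Hoelder continuous of exponent \<open>s\<close> and maps onto the unit interval. Hence a cover of
  the Cantor set yields a cover of the unit interval.\<close>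

lemma sign_cantor_set_cover_sum_ge:
  fixes U :: "nat \<Rightarrow> real set"
  assumes "a \<noteq> 0" "0 < r" "r \<le> 1/4" "0 < s" "r powr s = 1/2"
    and cover: "sign_cantor_set c a r \<subseteq> (\<Union>i. U i)" and bdd: "\<And>i. bounded (U i)"
  shows "ennreal (\<bar>a\<bar> powr s / 2) \<le> (\<Sum>i. diam_power s (U i))"
proof -
  \<comment> \<open>The Hoelder constant: if the first difference is at \<open>n\<close>, the images
    differ by at most \<open>1 / 2 ^ n = (r ^ n) powr s\<close>, and the points by at least
    \<open>\<bar>a\<bar> * r ^ n\<close>.\<close>
  define K where "K = \<bar>a\<bar> powr (-s)"
  have K0: "K > 0" using assms(1) by (simp add: K_def)
  let ?x = "\<lambda>\<eta>. c + a * power_sum r \<eta>"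
  have hoelder: "\<bar>rademacher_T \<eta> - rademacher_T \<eta>'\<bar> \<le> K * \<bar>?x \<eta> - ?x \<eta>'\<bar> powr s"
    if sg: "sign_seq \<eta>" "sign_seq \<eta>'" for \<eta> \<eta>'
  proof (cases "\<eta> = \<eta>'")
    case False
    define n where "n = (LEAST n. \<eta> n \<noteq> \<eta>' n)"
    have neq: "\<eta> n \<noteq> \<eta>' n" unfolding n_def by (rule LeastI_ex) (use False in auto)
    have agree: "\<And>k. k < n \<Longrightarrow> \<eta> k = \<eta>' k" unfolding n_def using not_less_Least by blast
    have "\<bar>rademacher_T \<eta> - rademacher_T \<eta>'\<bar> \<le> 1 / 2 ^ n"
      by (rule rademacher_T_close[OF sg agree])
    also have "\<dots> = (r powr s) ^ n" unfolding assms(5) by (simp add: power_divide)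
    also have "\<dots> = (r ^ n) powr s" using assms(2) by (simp add: powr_powr mult.commute flip: powr_realpow)
    also have "\<dots> = K * (\<bar>a\<bar> * r ^ n) powr s"
      using assms(1,2) by (simp add: K_def powr_mult powr_minus field_simps)
    also have "\<dots> \<le> K * \<bar>?x \<eta> - ?x \<eta>'\<bar> powr s"
    proof (intro mult_left_mono powr_mono2)
      have "\<bar>?x \<eta> - ?x \<eta>'\<bar> = \<bar>a\<bar> * \<bar>power_sum r \<eta> - power_sum r \<eta>'\<bar>"
        by (simp flip: abs_mult right_diff_distrib)
      then show "\<bar>a\<bar> * r ^ n \<le> \<bar>?x \<eta> - ?x \<eta>'\<bar>"
        using power_sum_diff_ge[OF sg assms(2,3) agree neq] by (simp add: mult_left_mono)
    qed (use K0 assms in auto)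
    finally show ?thesis .
  qed simp
  define B where "B i = {rademacher_T \<eta> |\<eta>. sign_seq \<eta> \<and> ?x \<eta> \<in> U i}" for i
  define D where "D i = K * diameter (U i) powr s" for i
  \<comment> \<open>\<open>B i\<close> need not be measurable, so it is enclosed in an interval
    around one of its points. Its length \<open>2 * D i\<close> causes the factor 1/2 in the
    bound.\<close>
  define I where "I i = (if B i = {} then {} else {(SOME b. b \<in> B i) - D i..(SOME b. b \<in> B i) + D i})" for i
  have BI: "B i \<subseteq> I i" for i
  proof
    fix b assume b: "b \<in> B i"
    then have p: "(SOME b. b \<in> B i) \<in> B i" by (rule someI)
    obtain \<eta> \<eta>' where \<eta>: "sign_seq \<eta>" "?x \<eta> \<in> U i" "b = rademacher_T \<eta>"
      and \<eta>': "sign_seq \<eta>'" "?x \<eta>' \<in> U i" "(SOME b. b \<in> B i) = rademacher_T \<eta>'"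
      using b p unfolding B_def by blast
    have "\<bar>?x \<eta> - ?x \<eta>'\<bar> \<le> diameter (U i)"
      using diameter_bounded_bound[OF bdd \<eta>(2) \<eta>'(2)] by (simp only: dist_real_def)
    then have "K * \<bar>?x \<eta> - ?x \<eta>'\<bar> powr s \<le> D i"
      unfolding D_def using K0 assms(4) by (intro mult_left_mono powr_mono2) auto
    then have "\<bar>b - (SOME b. b \<in> B i)\<bar> \<le> D i"
      using hoelder[OF \<eta>(1) \<eta>'(1)] unfolding \<eta>(3) \<eta>'(3) by linarith
    then show "b \<in> I i" using b by (auto simp: I_def)
  qed
  have "{0..1} \<subseteq> (\<Union>i. I i)"
  proof
    fix t :: real assume "t \<in> {0..1}"
    then obtain \<eta> where \<eta>: "sign_seq \<eta>" "rademacher_T \<eta> = t"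
      using rademacher_expansion_exists unfolding rademacher_expansion_def by blast
    have "?x \<eta> \<in> sign_cantor_set c a r" unfolding sign_cantor_set_def using \<eta>(1) by blast
    then obtain i where "?x \<eta> \<in> U i" using cover by blast
    then have "t \<in> B i" unfolding B_def using \<eta> by blast
    then show "t \<in> (\<Union>i. I i)" using BI by blast
  qed
  have meas: "I i \<in> sets lborel" for i by (simp add: I_def)
  have D0: "D i \<ge> 0" for i using K0 by (simp add: D_def)
  have "1 = emeasure lborel {0..1::real}" by simp
  also have "\<dots> \<le> emeasure lborel (\<Union>i. I i)"
    using \<open>{0..1} \<subseteq> (\<Union>i. I i)\<close> meas by (intro emeasure_mono) auto
  also have "\<dots> \<le> (\<Sum>i. emeasure lborel (I i))"
    using meas by (intro emeasure_subadditive_countably) auto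
  also have "\<dots> \<le> (\<Sum>i. ennreal (2 * K) * diam_power s (U i))"
  proof (rule suminf_le)
    fix i
    show "emeasure lborel (I i) \<le> ennreal (2 * K) * diam_power s (U i)"
    proof (cases "B i = {}")
      case False
      then have "U i \<noteq> {}" by (auto simp: B_def)
      moreover have "emeasure lborel (I i) = ennreal (2 * D i)"
        using False D0[of i] by (simp add: I_def)
      ultimately show ?thesis
        using assms(4) K0 by (simp add: diam_power_def D_def mult.assoc flip: ennreal_mult')
    qed (simp add: I_def)
  qed auto
  also have "\<dots> = ennreal (2 * K) * (\<Sum>i. diam_power s (U i))"
    by (rule ennreal_suminf_cmult)
  finally have "ennreal (1 / (2 * K)) * 1 \<le> ennreal (1 / (2 * K)) * (ennreal (2 * K) * (\<Sum>i. diam_power s (U i)))"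
    by (intro mult_left_mono) auto
  also have "\<dots> = (\<Sum>i. diam_power s (U i))"
    unfolding mult.assoc[symmetric] using K0 by (simp flip: ennreal_mult)
  finally have "ennreal (1 / (2 * K)) \<le> (\<Sum>i. diam_power s (U i))" by simp
  moreover have "1 / (2 * K) = \<bar>a\<bar> powr s / 2" by (simp add: K_def powr_minus field_simps)
  ultimately show ?thesis by simp
qed

text \<open>Sets of diameter at most 1 have larger diameter powers for smaller exponents, so the
  bound at \<open>s\<close> passes to every \<open>t \<le> s\<close>.\<close>

lemma hausdorff_premeasure_sign_cantor_set_ge:
  assumes "a \<noteq> 0" "0 < r" "r \<le> 1/4" "0 < s" "r powr s = 1/2" "0 \<le> t" "t \<le> s" "\<delta> \<le> 1"
  shows "ennreal (\<bar>a\<bar> powr s / 2) \<le> hausdorff_premeasure t \<delta> (sign_cantor_set c a r)"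
  unfolding hausdorff_premeasure_def
proof (rule INF_greatest)
  fix U :: "nat \<Rightarrow> real set"
  assume "U \<in> {U. sign_cantor_set c a r \<subseteq> (\<Union>i. U i) \<and> (\<forall>i. bounded (U i) \<and> diameter (U i) \<le> \<delta>)}"
  then have U: "sign_cantor_set c a r \<subseteq> (\<Union>i. U i)" "\<And>i. bounded (U i)" "\<And>i. diameter (U i) \<le> 1"
    using assms(8) order_trans by blast+
  have "ennreal (\<bar>a\<bar> powr s / 2) \<le> (\<Sum>i. diam_power s (U i))"
    by (rule sign_cantor_set_cover_sum_ge[OF assms(1-5) U(1,2)])
  also have "\<dots> \<le> (\<Sum>i. diam_power t (U i))"
  proof (rule suminf_le)
    fix i
    have d: "0 \<le> diameter (U i)" by (rule diameter_ge_0[OF U(2)])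
    have "diameter (U i) powr s \<le> diameter (U i) powr t"
      by (rule powr_mono'[OF assms(7) d U(3)])
    \<comment> \<open>For \<open>t = 0\<close>, where \<open>diam_power\<close> is 1 on every
      nonempty set.\<close>
    moreover have "diameter (U i) powr s \<le> 1"
      using powr_mono2[OF _ d U(3), of s] assms(4) by simp
    ultimately show "diam_power s (U i) \<le> diam_power t (U i)"
      using assms(4) by (auto simp: diam_power_def intro!: ennreal_leI)
  qed auto
  finally show "ennreal (\<bar>a\<bar> powr s / 2) \<le> (\<Sum>i. diam_power t (U i))" .
qed

lemma hausdorff_measure_sign_cantor_set_pos:
  assumes "a \<noteq> 0" "0 < r" "r \<le> 1/4" "0 < s" "r powr s = 1/2" "0 \<le> t" "t \<le> s"
  shows "0 < hausdorff_measure t (sign_cantor_set c a r)"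
proof -
  have "0 < ennreal (\<bar>a\<bar> powr s / 2)" using assms(1) by simp
  also have "\<dots> \<le> hausdorff_premeasure t 1 (sign_cantor_set c a r)"
    by (rule hausdorff_premeasure_sign_cantor_set_ge) (use assms in auto)
  also have "\<dots> \<le> hausdorff_measure t (sign_cantor_set c a r)"
    unfolding hausdorff_measure_def by (rule SUP_upper) simp
  finally show ?thesis .
qed

text \<open>Isolates the dependence on the level: the cost of the cover is constant in
  \<open>n\<close> for \<open>t = s\<close> and decays geometrically for
  \<open>t > s\<close>.\<close>

lemma sign_cantor_set_cover_value:
  fixes r s t a :: real
  assumes "0 < r" "r powr s = 1/2"
  shows "2 ^ n * (\<bar>a\<bar> * (3 * r ^ n)) powr t = (3 * \<bar>a\<bar>) powr t * (r powr (t - s)) ^ n"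
proof -
  have "r powr (t - s) = 2 * r powr t"
    unfolding powr_diff assms(2) by simp
  then have "(r powr (t - s)) ^ n = 2 ^ n * (r ^ n) powr t"
    using assms(1) by (simp add: power_mult_distrib powr_powr mult.commute flip: powr_realpow)
  moreover have "(\<bar>a\<bar> * (3 * r ^ n)) powr t = (3 * \<bar>a\<bar>) powr t * (r ^ n) powr t"
    using assms(1) by (simp add: mult_ac flip: powr_mult)
  ultimately show ?thesis by simp
qed

lemma sign_cantor_set_eventually_premeasure_le:
  assumes "0 < t" "0 < r" "r \<le> 1/4" "0 < \<delta>"
  shows "\<forall>\<^sub>F n in sequentially. hausdorff_premeasure t \<delta> (sign_cantor_set c a r)
    \<le> ennreal (2 ^ n * (\<bar>a\<bar> * (3 * r ^ n)) powr t)"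
proof -
  have "(\<lambda>n. \<bar>a\<bar> * (3 * r ^ n)) \<longlonglongrightarrow> \<bar>a\<bar> * (3 * 0)"
    by (intro tendsto_intros LIMSEQ_realpow_zero) (use assms in auto)
  then have "\<forall>\<^sub>F n in sequentially. \<bar>a\<bar> * (3 * r ^ n) < \<delta>"
    by (rule order_tendstoD(2)) (use assms in simp)
  then show ?thesis
    by eventually_elim (rule hausdorff_premeasure_sign_cantor_set_le[OF assms(1-3)], simp)
qed

lemma hausdorff_measure_sign_cantor_set_finite:
  assumes "0 < r" "r \<le> 1/4" "0 < s" "r powr s = 1/2"
  shows "hausdorff_measure s (sign_cantor_set c a r) < \<infinity>"
proof -
  have "hausdorff_premeasure s \<delta> (sign_cantor_set c a r) \<le> ennreal ((3 * \<bar>a\<bar>) powr s)"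
    if "\<delta> > 0" for \<delta>
    using sign_cantor_set_eventually_premeasure_le[OF assms(3,1,2) that, of c a] assms(1)
    unfolding sign_cantor_set_cover_value[OF assms(1,4)] by simp
  then have "hausdorff_measure s (sign_cantor_set c a r) \<le> ennreal ((3 * \<bar>a\<bar>) powr s)"
    unfolding hausdorff_measure_def by (intro SUP_least) auto
  then show ?thesis by (simp add: le_less_trans)
qed

lemma hausdorff_measure_sign_cantor_set_zero:
  assumes "0 < r" "r \<le> 1/4" "0 < s" "r powr s = 1/2" "s < t"
  shows "hausdorff_measure t (sign_cantor_set c a r) = 0"
proof -
  have "hausdorff_premeasure t \<delta> (sign_cantor_set c a r) \<le> ennreal 0" if "\<delta> > 0" for \<delta>
  proof (rule tendsto_lowerbound)
    show "\<forall>\<^sub>F n in sequentially. hausdorff_premeasure t \<delta> (sign_cantor_set c a r)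
        \<le> ennreal ((3 * \<bar>a\<bar>) powr t * (r powr (t - s)) ^ n)"
      using sign_cantor_set_eventually_premeasure_le[OF _ assms(1,2) that, of t c a] assms
      unfolding sign_cantor_set_cover_value[OF assms(1,4)] by simp
    have "r powr (t - s) < 1" using powr_less_mono2[of "t - s" r 1] assms by simp
    then have "(\<lambda>n. (3 * \<bar>a\<bar>) powr t * (r powr (t - s)) ^ n) \<longlonglongrightarrow> (3 * \<bar>a\<bar>) powr t * 0"
      by (intro tendsto_intros LIMSEQ_realpow_zero) auto
    then show "(\<lambda>n. ennreal ((3 * \<bar>a\<bar>) powr t * (r powr (t - s)) ^ n)) \<longlonglongrightarrow> ennreal 0"
      by (intro tendsto_ennrealI) simp
  qed auto
  then have "hausdorff_measure t (sign_cantor_set c a r) \<le> 0"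
    unfolding hausdorff_measure_def by (intro SUP_least) auto
  then show ?thesis by simp
qed

text \<open>The infimum is not attained, as the measure at \<open>s\<close> is positive; it is
  approached through \<open>s + e\<close>.\<close>

lemma hausdorff_dim_sign_cantor_set:
  assumes "a \<noteq> 0" "0 < r" "r \<le> 1/4" "0 < s" "r powr s = 1/2"
  shows "hausdorff_dim (sign_cantor_set c a r) = ereal s"
  unfolding hausdorff_dim_def
proof (rule antisym)
  let ?S = "{t. 0 \<le> t \<and> hausdorff_measure t (sign_cantor_set c a r) = 0}"
  show "(INF t\<in>?S. ereal t) \<le> ereal s"
  proof (rule ereal_le_epsilon2)
    fix e :: real assume "e > 0"
    then have "s + e \<in> ?S"
      using hausdorff_measure_sign_cantor_set_zero[OF assms(2-5), of "s + e"] assms(4) by auto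
    then have "(INF t\<in>?S. ereal t) \<le> ereal (s + e)" by (rule INF_lower)
    then show "(INF t\<in>?S. ereal t) \<le> ereal s + ereal e" by simp
  qed
  show "ereal s \<le> (INF t\<in>?S. ereal t)"
  proof (rule INF_greatest)
    fix t assume "t \<in> ?S"
    then show "ereal s \<le> ereal t"
      using hausdorff_measure_sign_cantor_set_pos[OF assms, of t c] by (cases "t \<le> s") auto
  qed
qed

section \<open>The case with a zero, and the dichotomy\<close>

lemma maximizers_zero:
  assumes "1 / 2 < \<alpha>" "\<alpha> < 2" "partial_sum \<alpha> (rho_sharp \<alpha>) (Suc n) = 0"
    and "\<And>i. 0 < i \<Longrightarrow> i \<le> n \<Longrightarrow> partial_sum \<alpha> (rho_sharp \<alpha>) i \<noteq> 0"
  defines "M \<equiv> maximizers (takagi_landsberg \<alpha>)" and "s \<equiv> 1 / (real n + 1)"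
  shows "M = {t \<in> {0..1}. \<exists>\<rho>. rademacher_expansion \<rho> t \<and> signed_blocks (rho_sharp \<alpha>) n \<rho>}"
    and "perfect_set M" and "hausdorff_dim M = ereal s"
    and "0 < hausdorff_measure s M" and "hausdorff_measure s M < \<infinity>"
proof -
  let ?\<sigma> = "rho_sharp \<alpha>"
  define a where "a = - (\<Sum>j\<le>n. ?\<sigma> j / 2 ^ j) / 4"
  define r where "r = (1/2::real) ^ (n + 1)"
  have s0: "?\<sigma> 0 = 1" by simp
  have M: "M = {rademacher_T \<rho> |\<rho>. sign_seq \<rho> \<and> signed_blocks ?\<sigma> n \<rho>}"
    unfolding M_def
    by (auto simp: mem_maximizers_iff optimal_iff_signed_blocks[OF assms(1-4)])
  then have MC: "M = sign_cantor_set (1/2) a r"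
    unfolding a_def r_def by (simp only: signed_blocks_sign_cantor_set[OF sign_seq_rho_sharp s0])
  have "(0::real) < 1 / 2 ^ n" by simp
  then have a0: "a \<noteq> 0"
    using block_weight_pos[OF sign_seq_rho_sharp s0, of n] unfolding a_def by linarith
  \<comment> \<open>The first partial sum is 1, so a block has at least two digits. This gives
    \<open>r \<le> 1/4\<close>, on which the separation of the pieces rests.\<close>
  have n1: "n \<ge> 1"
    using assms(3) by (cases n) (simp_all add: partial_sum_def)
  have r0: "0 < r" by (simp add: r_def)
  have r4: "r \<le> 1/4"
    using power_decreasing[of 2 "n + 1" "1/2::real"] n1 by (simp add: r_def power2_eq_square)
  have sp: "0 < s" by (simp add: s_def)
  have "r = (1/2) powr (real n + 1)"
    unfolding r_def by (subst powr_realpow[symmetric]) (simp_all add: add.commute)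
  then have rs: "r powr s = 1/2" unfolding s_def by (simp add: powr_powr)
  show "M = {t \<in> {0..1}. \<exists>\<rho>. rademacher_expansion \<rho> t \<and> signed_blocks ?\<sigma> n \<rho>}"
    unfolding M rademacher_expansion_def using rademacher_T_in_unit by blast
  have "closed M"
    unfolding M_def using assms(1,2) by (intro closed_maximizers continuous_on_takagi_landsberg) simp
  then show "perfect_set M"
    unfolding perfect_set_def using sign_cantor_set_not_isolated[OF a0 r0 r4] MC by blast
  show "hausdorff_dim M = ereal s"
    unfolding MC by (rule hausdorff_dim_sign_cantor_set[OF a0 r0 r4 sp rs])
  show "0 < hausdorff_measure s M"
    unfolding MC by (rule hausdorff_measure_sign_cantor_set_pos[OF a0 r0 r4 sp rs]) (use sp in auto)
  show "hausdorff_measure s M < \<infinity>"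
    unfolding MC by (rule hausdorff_measure_sign_cantor_set_finite[OF r0 r4 sp rs])
qed

theorem theorem3p7:
  fixes \<alpha> :: real
  assumes "1 / 2 < \<alpha>" and "\<alpha> < 2"
  shows "((\<forall>n. (\<Sum>m\<le>n. \<alpha> ^ m * rho_sharp \<alpha> m) \<noteq> 0) \<longrightarrow>
           card (maximizers (takagi_landsberg \<alpha>)) = 2 \<and>
           maximizers (takagi_landsberg \<alpha>) = {tau_sharp \<alpha>, 1 - tau_sharp \<alpha>} \<and>
           {\<rho>. rademacher_expansion \<rho> (tau_sharp \<alpha>)} = {rho_sharp \<alpha>} \<and>
           {\<rho>. rademacher_expansion \<rho> (1 - tau_sharp \<alpha>)} = {\<lambda>n. - rho_sharp \<alpha> n})
       \<and> ((\<exists>n. (\<Sum>m\<le>n. \<alpha> ^ m * rho_sharp \<alpha> m) = 0) \<longrightarrow>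
           (let n0 = (LEAST n. (\<Sum>m\<le>n. \<alpha> ^ m * rho_sharp \<alpha> m) = 0);
                M = maximizers (takagi_landsberg \<alpha>);
                s = 1 / (real n0 + 1)
            in M = {t \<in> {0..1}. \<exists>\<rho>. rademacher_expansion \<rho> t \<and> signed_blocks (rho_sharp \<alpha>) n0 \<rho>} \<and>
               perfect_set M \<and>
               hausdorff_dim M = ereal s \<and>
               0 < hausdorff_measure s M \<and> hausdorff_measure s M < \<infinity>))"
proof (rule conjI; rule impI)
  assume "\<forall>n. (\<Sum>m\<le>n. \<alpha> ^ m * rho_sharp \<alpha> m) \<noteq> 0"
  then have "partial_sum \<alpha> (rho_sharp \<alpha>) n \<noteq> 0" if "0 < n" for n
    using that unfolding partial_sum_atMost by (metis gr0_implies_Suc)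
  note m = maximizers_no_zero[OF assms this]
  show "card (maximizers (takagi_landsberg \<alpha>)) = 2 \<and>
      maximizers (takagi_landsberg \<alpha>) = {tau_sharp \<alpha>, 1 - tau_sharp \<alpha>} \<and>
      {\<rho>. rademacher_expansion \<rho> (tau_sharp \<alpha>)} = {rho_sharp \<alpha>} \<and>
      {\<rho>. rademacher_expansion \<rho> (1 - tau_sharp \<alpha>)} = {\<lambda>n. - rho_sharp \<alpha> n}"
    by (intro conjI m)
next
  let ?n0 = "LEAST n. (\<Sum>m\<le>n. \<alpha> ^ m * rho_sharp \<alpha> m) = 0"
  assume ex: "\<exists>n. (\<Sum>m\<le>n. \<alpha> ^ m * rho_sharp \<alpha> m) = 0"
  have z: "partial_sum \<alpha> (rho_sharp \<alpha>) (Suc ?n0) = 0"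
    using LeastI_ex[OF ex] by (simp only: partial_sum_atMost)
  \<comment> \<open>Index shift: \<open>partial_sum\<close> at \<open>i\<close> stops at
    \<open>i - 1\<close>, which is below the least zero.\<close>
  have "partial_sum \<alpha> (rho_sharp \<alpha>) i \<noteq> 0" if "0 < i" "i \<le> ?n0" for i
  proof -
    have "i - 1 < ?n0" using that by simp
    from not_less_Least[OF this]
    have "partial_sum \<alpha> (rho_sharp \<alpha>) (Suc (i - 1)) \<noteq> 0"
      by (simp only: partial_sum_atMost not_False_eq_True)
    then show ?thesis using that(1) by simp
  qed
  note m = maximizers_zero[OF assms z this]
  show "let n0 = ?n0; M = maximizers (takagi_landsberg \<alpha>); s = 1 / (real n0 + 1)
      in M = {t \<in> {0..1}. \<exists>\<rho>. rademacher_expansion \<rho> t \<and> signed_blocks (rho_sharp \<alpha>) n0 \<rho>} \<and>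
        perfect_set M \<and> hausdorff_dim M = ereal s \<and>
        0 < hausdorff_measure s M \<and> hausdorff_measure s M < \<infinity>"
    unfolding Let_def by (intro conjI m)
qed

end
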